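(* Let $A\in\mathcal{M}_n$ be accretive and let $0<t<\frac12$. Then \[ \omega(A^t)\ \geq\ \omega^t(A), \] where $\omega^t(A)$ means $(\omega(A))^t$.
   Context: $\mathcal{M}_n$ is the algebra of $n\times n$ complex matrices, and $\omega(A)=\max\{|\langle Ax,x\rangle| : x\in\mathbb{C}^n,\ \|x\|=1\}$ is the numerical radius. The numerical range is $W(A)=\{\langle Ax,x\rangle : x\in\mathbb{C}^n,\ \|x\|=1\}$. $A$ is accretive if $W(A)\subseteq\{z\in\mathbb{C}:\Re z>0\}$, equivalently if $\frac{A+A^*}{2}$ is positive definite. For $A$ with $W(A)\cap(-\infty,0]=\varnothing$ and $t\in(0,1)$, $A^t$ is the principal fractional power \[ A^t=\frac{1}{2\pi i}\int_{\Omega_A} z^t(zI-A)^{-1}\,dz, \] where $z^t$ is the principal power and $\Omega_A$ is a contour in the resolvent set of $A$ that winds once about each eigenvalue of $A$ and avoids $(-\infty,0]$. Equivalently, $A^t=\frac{\sin(t\pi)}{\pi}\int_0^\infty s^{t-1}A(sI+A)^{-1}\,ds$. *)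

theory Defs
  imports "HOL-Complex_Analysis.Complex_Analysis"
begin

(* The inner product of the library on complex ^ 'n is real-valued (it is the real part of this
   one), so the complex inner product is introduced here.  The norm it induces is the library
   norm on complex ^ 'n. *)
definition cinner :: "complex ^ 'n \<Rightarrow> complex ^ 'n \<Rightarrow> complex" where
  "cinner x y = (\<Sum>i\<in>UNIV. x $ i * cnj (y $ i))"

lemma cinner_self: "cinner x x = of_real ((norm x)\<^sup>2)"
  by (simp add: cinner_def norm_vec_def L2_set_def complex_norm_square sum_nonneg del: of_real_power)

definition numerical_range :: "complex ^ 'n ^ 'n \<Rightarrow> complex set" where
  "numerical_range A = {cinner (A *v x) x | x. norm x = 1}"

(* The supremum is a maximum: see numerical_radius_attained and numerical_radius_upper. *)
definition numerical_radius :: "complex ^ 'n ^ 'n \<Rightarrow> real" where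
  "numerical_radius A = (SUP x\<in>{x. norm x = 1}. cmod (cinner (A *v x) x))"

definition accretive :: "complex ^ 'n ^ 'n \<Rightarrow> bool" where
  "accretive A \<longleftrightarrow> numerical_range A \<subseteq> {z. Re z > 0}"

definition eigenvalue :: "complex ^ 'n ^ 'n \<Rightarrow> complex \<Rightarrow> bool" where
  "eigenvalue A z \<longleftrightarrow> (\<exists>v. v \<noteq> 0 \<and> A *v v = z *s v)"

(* mat z is the scalar matrix zI. *)
definition resolvent_set :: "complex ^ 'n ^ 'n \<Rightarrow> complex set" where
  "resolvent_set A = {z. invertible (mat z - A)}"

definition power_contour :: "complex ^ 'n ^ 'n \<Rightarrow> (real \<Rightarrow> complex) \<Rightarrow> bool" where
  "power_contour A \<gamma> \<longleftrightarrow>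
     valid_path \<gamma> \<and> pathfinish \<gamma> = pathstart \<gamma> \<and>
     path_image \<gamma> \<subseteq> resolvent_set A \<and> path_image \<gamma> \<inter> \<real>\<^sub>\<le>\<^sub>0 = {} \<and>
     (\<forall>z. eigenvalue A z \<longrightarrow> winding_number \<gamma> z = 1)"

(* The matrix-valued contour integral is taken entrywise; complex powr is the principal power. *)
definition contour_power :: "(real \<Rightarrow> complex) \<Rightarrow> complex ^ 'n ^ 'n \<Rightarrow> real \<Rightarrow> complex ^ 'n ^ 'n" where
  "contour_power \<gamma> A t =
     (\<chi> i j. 1 / (2 * of_real pi * \<i>) *
        contour_integral \<gamma> (\<lambda>z. z powr of_real t * matrix_inv (mat z - A) $ i $ j))"

(* By Cauchy's theorem the integral does not depend on the contour, so an arbitrary admissible one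
   is chosen.  The definition is meaningful only if one exists, as it does when the numerical range
   does not meet (-infinity, 0]; for accretive A see accretive_power_contour. *)
definition fractional_power :: "complex ^ 'n ^ 'n \<Rightarrow> real \<Rightarrow> complex ^ 'n ^ 'n" where
  "fractional_power A t = contour_power (SOME \<gamma>. power_contour A \<gamma>) A t"

lemma compact_numerical_range:
  fixes A :: "complex ^ 'n ^ 'n"
  shows "compact (numerical_range A)"
proof -
  have "compact {x :: complex ^ 'n. norm x = 1}"
    using compact_sphere[of "0 :: complex ^ 'n" 1] by (simp add: sphere_def dist_norm)
  moreover have "continuous_on {x :: complex ^ 'n. norm x = 1} (\<lambda>x. cinner (A *v x) x)"
    unfolding cinner_def matrix_vector_mult_def by (auto intro!: continuous_intros)
  ultimately have "compact ((\<lambda>x. cinner (A *v x) x) ` {x. norm x = 1})"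
    by (rule compact_continuous_image[rotated])
  thus ?thesis by (simp add: numerical_range_def setcompr_eq_image)
qed

lemma numerical_range_nonempty:
  fixes A :: "complex ^ 'n ^ 'n"
  shows "numerical_range A \<noteq> {}"
proof -
  have "norm (axis undefined 1 :: complex ^ 'n) = 1" by simp
  thus ?thesis unfolding numerical_range_def by blast
qed

lemma numerical_radius_eq_Sup: "numerical_radius A = Sup (cmod ` numerical_range A)"
  unfolding numerical_radius_def numerical_range_def
  by (rule arg_cong[of _ _ Sup]) auto

lemma numerical_radius_upper:
  assumes "norm x = 1"
  shows "cmod (cinner (A *v x) x) \<le> numerical_radius A"
proof -
  have "bounded (numerical_range A)" by (simp add: compact_imp_bounded compact_numerical_range)
  then have "bdd_above (cmod ` numerical_range A)"
    by (auto simp: bounded_iff bdd_above_def)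
  moreover have "cinner (A *v x) x \<in> numerical_range A"
    using assms by (auto simp: numerical_range_def)
  ultimately show ?thesis unfolding numerical_radius_eq_Sup by (rule cSUP_upper[rotated])
qed

lemma numerical_radius_attained:
  "\<exists>x. norm x = 1 \<and> numerical_radius A = cmod (cinner (A *v x) x)"
proof -
  have "continuous_on (numerical_range A) cmod" by (intro continuous_intros)
  from continuous_attains_sup[OF compact_numerical_range numerical_range_nonempty this]
  obtain w where w: "w \<in> numerical_range A" "\<forall>y\<in>numerical_range A. cmod y \<le> cmod w" by blast
  then have "numerical_radius A = cmod w"
    unfolding numerical_radius_eq_Sup by (intro cSup_eq_maximum) auto
  with w show ?thesis by (auto simp: numerical_range_def)
qed

lemma eigenvalue_in_numerical_range:
  assumes "eigenvalue A z"
  shows "z \<in> numerical_range A"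
proof -
  from assms obtain v where v: "v \<noteq> 0" "A *v v = z *s v" by (auto simp: eigenvalue_def)
  define c where "c = complex_of_real (1 / norm v)"
  define x where "x = c *s v"
  have xv: "x = (1 / norm v) *\<^sub>R v"
    by (simp add: x_def c_def vec_eq_iff scaleR_conv_of_real[where 'a = complex])
  then have n: "norm x = 1" using v by simp
  have "A *v x = c *s (A *v v)"
    by (simp add: x_def vector_scalar_commute)
  also have "\<dots> = z *s x" by (simp add: v x_def vec_eq_iff)
  finally have "cinner (A *v x) x = z * cinner x x"
    by (simp add: cinner_def sum_distrib_left mult_ac)
  then have "cinner (A *v x) x = z" using n by (simp add: cinner_self)
  with n show ?thesis by (force simp: numerical_range_def)
qed

lemma not_eigenvalue_imp_resolvent_set:
  assumes "\<not> eigenvalue A z"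
  shows "z \<in> resolvent_set A"
proof -
  have "x = 0" if "(mat z - A) *v x = 0" for x
  proof -
    have "mat z *v x = z *s x"
      by (simp add: matrix_vector_mult_def mat_def vec_eq_iff if_distrib if_distribR cong: if_cong)
    with that have "A *v x = z *s x" by (simp add: matrix_vector_mult_diff_rdistrib)
    with assms show ?thesis by (auto simp: eigenvalue_def)
  qed
  then have "\<exists>B. B ** (mat z - A) = mat 1" by (auto simp: matrix_left_invertible_ker)
  thus ?thesis by (simp add: resolvent_set_def invertible_left_inverse)
qed

lemma accretive_power_contour:
  assumes "accretive A"
  shows "\<exists>\<gamma>. power_contour A \<gamma>"
proof -
  have "continuous_on (numerical_range A) Re" by (intro continuous_intros)
  from continuous_attains_inf[OF compact_numerical_range numerical_range_nonempty this]
  obtain w where w: "w \<in> numerical_range A" "\<forall>y\<in>numerical_range A. Re w \<le> Re y" by blast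
  define m where "m = Re w"
  have m: "m > 0" using assms w by (auto simp: accretive_def m_def)
  obtain B where B: "\<forall>z\<in>numerical_range A. cmod z \<le> B"
    using compact_imp_bounded[OF compact_numerical_range, of A] by (auto simp: bounded_iff)
  define R where "R = B\<^sup>2 / m + m"
  define r where "r = sqrt (R\<^sup>2 - R * m / 2)"
  have Rm: "R \<ge> m" using m by (simp add: R_def)
  have BR: "B\<^sup>2 \<le> R * m" using m by (simp add: R_def field_simps)
  have "R * m \<le> R * R" using Rm m by (intro mult_left_mono) auto
  moreover have Rm0: "R * m > 0" using Rm m by simp
  ultimately have pos: "R\<^sup>2 - R * m / 2 > 0" unfolding power2_eq_square by linarith
  have r: "r > 0" "r\<^sup>2 = R\<^sup>2 - R * m / 2" using pos by (auto simp: r_def)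
  have r2: "r\<^sup>2 < R\<^sup>2" using r(2) Rm0 by simp
  have R0: "0 \<le> R" using Rm m by linarith
  have rR: "r < R" by (rule power2_less_imp_less[OF r2 R0])
  have inside: "cmod (z - of_real R) < r" if "eigenvalue A z" for z
  proof -
    have z: "z \<in> numerical_range A" using that by (rule eigenvalue_in_numerical_range)
    have "(cmod z)\<^sup>2 \<le> B\<^sup>2" using B z by (intro power_mono) auto
    moreover have "R * m \<le> R * Re z" using w z Rm m by (intro mult_left_mono) (auto simp: m_def)
    moreover have "(cmod (z - of_real R))\<^sup>2 = (cmod z)\<^sup>2 - 2 * (R * Re z) + R\<^sup>2"
      unfolding cmod_power2 by (simp add: power2_eq_square algebra_simps)
    ultimately have "(cmod (z - of_real R))\<^sup>2 < r\<^sup>2" using BR Rm0 r(2) by linarith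
    from power2_less_imp_less[OF this] show ?thesis using r(1) by simp
  qed
  have "power_contour A (circlepath (of_real R) r)"
    unfolding power_contour_def
  proof (intro conjI allI impI)
    show "path_image (circlepath (of_real R) r) \<subseteq> resolvent_set A"
      using r inside
      by (force intro!: not_eigenvalue_imp_resolvent_set simp: dist_norm norm_minus_commute)
    have "dist (of_real R) z > r" if "z \<in> \<real>\<^sub>\<le>\<^sub>0" for z :: complex
    proof -
      have "R \<le> \<bar>Re (of_real R - z)\<bar>" using that Rm m by (auto simp: complex_nonpos_Reals_iff)
      also have "\<dots> \<le> dist (of_real R) z" unfolding dist_norm by (rule abs_Re_le_cmod)
      finally show ?thesis using rR by simp
    qed
    then show "path_image (circlepath (of_real R) r) \<inter> \<real>\<^sub>\<le>\<^sub>0 = {}" using r by force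
  qed (use r inside in \<open>auto intro!: winding_number_circlepath\<close>)
  then show ?thesis by blast
qed

end

theory Submission
  imports Defs
begin

text \<open>
  Suppose \<open>|\<langle>A\<^sup>t x, x\<rangle>| \<le> |a0|\<^sup>t\<close> for all unit vectors \<open>x\<close>, where \<open>Re a0 > 0\<close>.  Split off the pole \<open>a0\<close>,
  the only one in the right half-plane:
  \<open>1 / (1 - a / a0) = t / (1 - (a / a0)\<^sup>t) + G a\<close>.
  With \<open>a = a0 exp \<zeta>\<close>, \<open>|Im \<zeta>| < \<pi>\<close>, the remainder \<open>G\<close> has nonnegative real part for \<open>t \<le> 1/2\<close>: from
  exponent \<open>1\<close> to \<open>1/2\<close> the change is \<open>1 / (2 (1 + exp (\<zeta> / 2)))\<close>, and below \<open>1/2\<close> the function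
  \<open>s / (1 - exp (s \<zeta>))\<close> has real part increasing in \<open>s\<close>.  By von Neumann's inequality (in its Poisson
  kernel form, on a circle in the right half-plane around which \<open>A\<close> is a contraction) \<open>Re G(A) \<ge> 0\<close>,
  while the first term, applied to \<open>A\<close>, has nonnegative real part by the assumption on \<open>A\<^sup>t\<close>.  Hence
  \<open>Re (I - A / a0) \<ge> 0\<close>.  If the claim failed, choosing \<open>a0\<close> in the direction of a maximal value
  \<open>\<langle>A x, x\<rangle>\<close>, but slightly shorter, would contradict this.
\<close>

section \<open>The scalar inequality\<close>

lemma sinh_ge_self: "0 \<le> x \<Longrightarrow> x \<le> sinh (x::real)"
proof -
  assume x: "0 \<le> x"
  have "(\<lambda>x. sinh x - x) 0 \<le> (\<lambda>x. sinh x - x) x"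
    by (rule DERIV_nonneg_imp_nondecreasing[OF x])
      (auto intro!: derivative_eq_intros simp: cosh_real_ge_1)
  then show ?thesis by simp
qed

lemma sinh_le_mult_cosh: "0 \<le> x \<Longrightarrow> sinh x \<le> x * cosh (x::real)"
proof -
  assume x: "0 \<le> x"
  have "(\<lambda>x. x * cosh x - sinh x) 0 \<le> (\<lambda>x. x * cosh x - sinh x) x"
    by (rule DERIV_nonneg_imp_nondecreasing[OF x])
      (auto intro!: derivative_eq_intros)
  then show ?thesis by simp
qed

text \<open>In \<open>kernel_nonneg\<close> the term \<open>y * sin y * sinh x\<close> has the sign
  of \<open>sinh x\<close>, so a lower bound serves \<open>0 <= x\<close> and an upper bound serves
  \<open>x < 0\<close>. Both sides are even in \<open>y\<close>. The lower bound is
  \<open>sin u <= u\<close> times \<open>sin u\<close>; the upper one follows by differentiating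
  twice.\<close>

lemma mult_sin_bounds:
  fixes y :: real
  assumes "\<bar>y\<bar> \<le> pi / 2"
  shows "1 - (cos y)\<^sup>2 \<le> y * sin y" and "y * sin y \<le> 2 * (1 - cos y)"
proof -
  have *: "1 - (cos u)\<^sup>2 \<le> u * sin u \<and> u * sin u \<le> 2 * (1 - cos u)" if u: "0 \<le> u" "u \<le> pi / 2" for u :: real
  proof
    have s: "0 \<le> sin u" "sin u \<le> u" using u by (auto intro!: sin_ge_zero sin_x_le_x)
    have "1 - (cos u)\<^sup>2 = sin u * sin u" using sin_cos_squared_add[of u] by (simp add: power2_eq_square)
    also have "\<dots> \<le> u * sin u" using s by (intro mult_right_mono)
    finally show "1 - (cos u)\<^sup>2 \<le> u * sin u" .
    have "(\<lambda>u. 2 * (1 - cos u) - u * sin u) 0 \<le> (\<lambda>u. 2 * (1 - cos u) - u * sin u) u"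
    proof (rule DERIV_nonneg_imp_nondecreasing[OF u(1)])
      fix w assume w: "0 \<le> w" "w \<le> u"
      have "(\<lambda>w. sin w - w * cos w) 0 \<le> (\<lambda>w. sin w - w * cos w) w"
      proof (rule DERIV_nonneg_imp_nondecreasing[OF w(1)])
        fix v assume "0 \<le> v" "v \<le> w"
        moreover then have "0 \<le> sin v" using w u by (intro sin_ge_zero) auto
        ultimately show "\<exists>d. ((\<lambda>w. sin w - w * cos w) has_real_derivative d) (at v) \<and> 0 \<le> d"
          by (intro exI[of _ "v * sin v"] conjI) (auto intro!: derivative_eq_intros simp: algebra_simps)
      qed
      then show "\<exists>d. ((\<lambda>u. 2 * (1 - cos u) - u * sin u) has_real_derivative d) (at w) \<and> 0 \<le> d"
        by (intro exI[of _ "sin w - w * cos w"] conjI) (auto intro!: derivative_eq_intros simp: algebra_simps)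
    qed
    then show "u * sin u \<le> 2 * (1 - cos u)" by simp
  qed
  have "\<bar>y\<bar> * sin \<bar>y\<bar> = y * sin y" "cos \<bar>y\<bar> = cos y" by (auto simp: abs_if)
  with *[of "\<bar>y\<bar>"] assms show "1 - (cos y)\<^sup>2 \<le> y * sin y" "y * sin y \<le> 2 * (1 - cos y)" by auto
qed

text \<open>The real form of \<open>Re_kernel_nonneg\<close> for \<open>u = x + i y\<close>. After
  \<open>y * sin y\<close> is replaced by its bounds in \<open>c = cos y\<close>, only an inequality
  in \<open>x\<close> and \<open>c\<close>, with \<open>c\<close> between 0 and 1, remains.\<close>

lemma kernel_nonneg:
  fixes x y :: real
  assumes y: "\<bar>y\<bar> \<le> pi / 2"
  shows "0 \<le> (cosh x - cos y) * (cosh x - cos y - sinh x) + x * (cosh x * cos y - 1) + y * sin y * sinh x"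
proof -
  define c where "c = cos y"
  have c: "0 \<le> c" "c \<le> 1" using y by (auto simp: c_def intro!: cos_ge_zero)
  note ys = mult_sin_bounds[OF y, folded c_def]
  define C where "C = cosh x"
  define S where "S = sinh x"
  have C1: "C \<ge> 1" by (simp add: C_def cosh_real_ge_1)
  have CS: "C * C = 1 + S * S"
    using cosh_square_eq[of x] by (simp add: C_def S_def power2_eq_square)
  have "0 \<le> (C - c) * (C - c - S) + x * (C * c - 1) + y * sin y * S"
  proof (cases "0 \<le> x")
    case True
    define E where "E = exp (- x)"
    have E: "C - S = E" "E * (C + S) = 1"
      by (simp_all add: C_def S_def E_def cosh_minus_sinh cosh_plus_sinh flip: exp_add)
    have E1: "1 - x \<le> E" using exp_ge_add_one_self[of "-x"] by (simp add: E_def)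
    have S: "x \<le> S" using True by (simp add: S_def sinh_ge_self)
    have "C * E + S * E = 1" using E(2) by (simp add: algebra_simps)
    moreover have "C * E - S * E = E * E" unfolding E(1)[symmetric] by (simp add: algebra_simps)
    ultimately have CE2: "2 * (C * E) = 1 + E * E" by simp
    have EE: "1 - 2 * x \<le> E * E"
      using exp_ge_add_one_self[of "-2*x"] by (simp add: E_def flip: exp_add)
    have f0: "1 - S \<le> C * E + S - x" using CE2 EE S by linarith
    have f0': "0 \<le> C * E + S - x" using CE2 S zero_le_square[of E] by linarith
    have f1: "0 \<le> (C - 1) * (E - 1 + x)" using C1 E1 by simp
    \<comment> \<open>Since \<open>c\<close> lies in [0,1], the left side is at most
      \<open>1 - S\<close> or at most 0, according to the sign of \<open>1 - S\<close>.\<close>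
    have A: "(1 - S) * c \<le> C * E + S - x"
    proof (cases "S \<le> 1")
      case True
      then have "(1 - S) * c \<le> (1 - S) * 1" using c by (intro mult_left_mono) auto
      then show ?thesis using f0 by simp
    next
      case False
      then have "(1 - S) * c \<le> 0" using c by (intro mult_nonpos_nonneg) auto
      then show ?thesis using f0' by simp
    qed
    have "(1 - c\<^sup>2) * S \<le> y * sin y * S" using ys(1) S True by (intro mult_right_mono) auto
    \<comment> \<open>The lower bound for the expression is quadratic in \<open>c\<close>; it is
      split with the weights \<open>1 - c\<close> and \<open>c\<close> so that each cofactor is
      nonnegative.\<close>
    moreover have "(C - c) * (C - c - S) + x * (C * c - 1) + (1 - c\<^sup>2) * S
       = (1 - c) * (C * E + S - x - (1 - S) * c) + c * ((C - 1) * (E - 1 + x))"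
      unfolding E(1)[symmetric] by (simp add: power2_eq_square algebra_simps)
    moreover have "0 \<le> (1 - c) * (C * E + S - x - (1 - S) * c)" using c A by simp
    moreover have "0 \<le> c * ((C - 1) * (E - 1 + x))" using c f1 by (intro mult_nonneg_nonneg[OF _ f1])
    ultimately show ?thesis by linarith
  next
    case False
    define v where "v = - x"
    define s where "s = sinh v"
    have v: "0 \<le> v" using False by (simp add: v_def)
    have Ss: "S = - s" by (simp add: S_def s_def v_def)
    have Cv: "C = cosh v" by (simp add: C_def v_def)
    have vs: "v \<le> s" "s \<le> v * C" using v by (auto simp: s_def Cv sinh_ge_self sinh_le_mult_cosh)
    have s0: "0 \<le> s" using v vs by simp
    have "y * sin y * s \<le> 2 * (1 - c) * s" using ys(2) s0 by (intro mult_right_mono)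
    \<comment> \<open>The sign of \<open>C * c - 1\<close> decides whether \<open>v\<close> is
      bounded above by \<open>s\<close> or below by \<open>s / C\<close> (that is,
      \<open>tanh v <= v\<close>). The surplus is \<open>s * (C - 1) * (1 - c)\<close> in the first
      case and \<open>s * (C - 1)^2 / C\<close> in the second.\<close>
    moreover have "v * (C * c - 1) + 2 * (1 - c) * s \<le> s * (C - c)"
    proof (cases "1 \<le> C * c")
      case True
      have "v * (C * c - 1) \<le> s * (C * c - 1)" using vs True by (intro mult_right_mono) auto
      moreover have "0 \<le> s * ((C - 1) * (1 - c))" using s0 C1 c by (intro mult_nonneg_nonneg) auto
      ultimately show ?thesis by (simp add: algebra_simps)
    next
      case False
      have sv: "s / C \<le> v" using vs C1 by (simp add: field_simps)
      have "s / C * (1 - C * c) \<le> v * (1 - C * c)" using False by (intro mult_right_mono[OF sv]) auto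
      moreover have "s / C * (1 - C * c) = s / C - s * c" using C1 by (simp add: field_simps)
      moreover have "0 \<le> s * ((C - 1)\<^sup>2 / C)" using s0 C1 by simp
      moreover have "s * ((C - 1)\<^sup>2 / C) = s * C - 2 * s + s / C" using C1 by (simp add: field_simps power2_eq_square)
      ultimately show ?thesis by (simp add: algebra_simps)
    qed
    moreover have "0 \<le> (C - c) * (C - c)" by simp
    ultimately show ?thesis by (simp add: Ss v_def algebra_simps)
  qed
  then show ?thesis by (simp add: C_def S_def c_def)
qed

lemma add_divide_power2: "a \<noteq> 0 \<Longrightarrow> 1 / a + b / a\<^sup>2 = (a + b) / a\<^sup>2" for a b :: complex
  by (simp add: field_simps power2_eq_square)

text \<open>For \<open>u = s * z\<close> the expression is the derivative of
  \<open>s / (1 - exp (s * z))\<close> with respect to \<open>s\<close>; its sign gives the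
  monotonicity in \<open>s\<close>.\<close>

lemma Re_kernel_nonneg:
  fixes u :: complex
  assumes "\<bar>Im u\<bar> \<le> pi / 2" and ne: "exp u \<noteq> 1"
  shows "0 \<le> Re (1 / (1 - exp u) + u * exp u / (1 - exp u)\<^sup>2)"
proof -
  define x y where "x = Re u" and "y = Im u"
  define C S c s where "C = cosh x" and "S = sinh x" and "c = cos y" and "s = sin y"
  have CS: "C * C = 1 + S * S" using cosh_square_eq[of x] by (simp add: C_def S_def power2_eq_square)
  have cs: "s * s + c * c = 1" using sin_cos_squared_add[of y] by (simp add: c_def s_def power2_eq_square)
  \<comment> \<open>\<open>n\<close> and \<open>k\<close> are the numerator and the denominator of
    the combined fraction after both are divided by \<open>exp u\<close>. The sign of
    \<open>Re (n / k)\<close> is that of \<open>Re (n * cnj k)\<close>, which is twice the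
    expression in \<open>kernel_nonneg\<close>.\<close>
  define k where "k = exp u + exp (-u) - 2"
  define n where "n = exp (-u) - 1 + u"
  have e: "exp (-u) * exp u = 1" by (simp flip: exp_add)
  then have kk: "k * exp u = (1 - exp u)\<^sup>2" by (simp add: k_def power2_eq_square algebra_simps)
  then have k0: "k \<noteq> 0" using ne by auto
  have e0: "exp u \<noteq> 0" by simp
  have "1 / (1 - exp u) + u * exp u / (1 - exp u)\<^sup>2 = (1 - exp u + u * exp u) / (1 - exp u)\<^sup>2"
    using add_divide_power2[of "1 - exp u" "u * exp u"] ne by simp
  also have "1 - exp u + u * exp u = n * exp u" using e by (simp add: n_def algebra_simps)
  also have "n * exp u / (1 - exp u)\<^sup>2 = n / k" using e0 k0 by (simp add: kk[symmetric])
  finally have eq: "1 / (1 - exp u) + u * exp u / (1 - exp u)\<^sup>2 = n / k" .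
  have ep: "exp x = C + S" "exp (-x) = C - S"
    by (simp_all add: C_def S_def cosh_minus_sinh cosh_plus_sinh)
  have "Re k = 2 * (C * c - 1)" "Im k = 2 * (S * s)" "Re n = (C - S) * c - 1 + x" "Im n = y - (C - S) * s"
    unfolding k_def n_def by (simp_all add: Re_exp Im_exp ep flip: x_def y_def c_def s_def) (simp_all add: ep algebra_simps)
  moreover have "Re (n * cnj k) = Re n * Re k + Im n * Im k" by simp
  ultimately have "Re (n * cnj k) = 2 * (((C - S) * c - 1 + x) * (C * c - 1) + (y - (C - S) * s) * (S * s))"
    by (simp only:) (simp add: algebra_simps)
  also have "\<dots> = 2 * ((C - c) * (C - c - S) + x * (C * c - 1) + y * s * S)"
    using CS cs by algebra
  finally have "0 \<le> Re (n * cnj k)"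
    using kernel_nonneg[of y x] assms(1) by (simp add: C_def S_def c_def s_def x_def y_def)
  then have "0 \<le> Re (n * cnj k) / (cmod k)\<^sup>2" by simp
  also have "\<dots> = Re (n / k)"
    by (subst complex_div_cnj[of n k]) (simp add: Re_divide_of_real flip: of_real_power)
  finally show ?thesis unfolding eq .
qed

lemma exp_neq_1_strip:
  fixes z :: complex
  assumes "z \<noteq> 0" "\<bar>Im z\<bar> < 2 * pi"
  shows "exp z \<noteq> 1"
proof
  assume "exp z = 1"
  then obtain n :: int where n: "Re z = 0" "Im z = of_int (2 * n) * pi" by (auto simp: exp_eq_1)
  then have "\<bar>of_int n\<bar> * pi < 1 * pi" using assms(2) by (simp add: abs_mult)
  then have "n = 0" by simp
  with n assms(1) show False by (simp add: complex_eq_iff)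
qed

text \<open>The exponent moves from \<open>t\<close> up to \<open>1/2\<close> by monotonicity, where
  \<open>s <= 1/2\<close> keeps \<open>Im (s * z)\<close> within the range of the kernel inequality.
  The remaining step from \<open>1/2\<close> to 1 is an exact identity with a remainder of
  nonnegative real part.\<close>

lemma Re_inverse_one_minus_exp_scaled:
  fixes z :: complex and t :: real
  assumes z: "z \<noteq> 0" "\<bar>Im z\<bar> \<le> pi" and t: "0 < t" "t \<le> 1 / 2"
  shows "Re (of_real t / (1 - exp (of_real t * z))) \<le> Re (1 / (1 - exp z))"
proof -
  define F where "F = (\<lambda>s::real. of_real s / (1 - exp (of_real s * z)))"
  have ne: "exp (of_real s * z) \<noteq> 1" if "0 < s" "s \<le> 1" for s
  proof (rule exp_neq_1_strip)
    have "s * \<bar>Im z\<bar> \<le> 1 * pi" using that z by (intro mult_mono) auto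
    then show "\<bar>Im (of_real s * z)\<bar> < 2 * pi" using that by (simp add: abs_mult) (use pi_gt_zero in linarith)
  qed (use that z in auto)
  have "(\<lambda>s. Re (F s)) t \<le> (\<lambda>s. Re (F s)) (1/2)"
  proof (rule DERIV_nonneg_imp_nondecreasing[OF t(2)])
    fix s assume s: "t \<le> s" "s \<le> 1 / 2"
    define u where "u = of_real s * z"
    have n: "exp u \<noteq> 1" using ne[of s] s t by (simp add: u_def)
    have "s * \<bar>Im z\<bar> \<le> 1 / 2 * pi" using s t z by (intro mult_mono) auto
    then have i: "\<bar>Im u\<bar> \<le> pi / 2" using s t by (simp add: u_def abs_mult)
    have "(F has_vector_derivative (1 / (1 - exp u) + u * exp u / (1 - exp u)\<^sup>2)) (at s)"
    proof -
      have "((\<lambda>w. w / (1 - exp (w * z))) has_field_derivative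
          (1 * (1 - exp u) - of_real s * (0 - exp u * z)) / ((1 - exp u) * (1 - exp u))) (at (of_real s))"
        using n unfolding u_def by (intro DERIV_divide) (auto intro!: derivative_eq_intros)
      also have "(1 * (1 - exp u) - of_real s * (0 - exp u * z)) / ((1 - exp u) * (1 - exp u))
          = 1 / (1 - exp u) + u * exp u / (1 - exp u)\<^sup>2"
        using n by (subst add_divide_power2) (auto simp: u_def power2_eq_square mult_ac)
      finally show ?thesis unfolding F_def by (rule has_vector_derivative_real_field)
    qed
    from bounded_linear.has_vector_derivative[OF bounded_linear_Re this]
    have "((\<lambda>s. Re (F s)) has_real_derivative Re (1 / (1 - exp u) + u * exp u / (1 - exp u)\<^sup>2)) (at s)"
      by (simp add: has_real_derivative_iff_has_vector_derivative)
    with Re_kernel_nonneg[OF i n]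
    show "\<exists>y. ((\<lambda>s. Re (F s)) has_real_derivative y) (at s) \<and> 0 \<le> y" by blast
  qed
  also have "Re (F (1/2)) \<le> Re (1 / (1 - exp z))"
  proof -
    \<comment> \<open>The remainder comes from the partial fractions of
      \<open>1 / (1 - w^2)\<close>; \<open>Re w >= 0\<close> because the argument
      \<open>Im z / 2\<close> is at most \<open>pi / 2\<close> in modulus.\<close>
    define w where "w = exp (z / 2)"
    have w: "w * w = exp z" by (simp add: w_def flip: exp_add)
    have w1: "w \<noteq> 1" "w * w \<noteq> 1" using ne[of "1/2"] ne[of 1] by (simp_all add: w) (simp add: w_def)
    have w2: "1 + w \<noteq> 0" using w1(2) by (metis add.inverse_inverse add_eq_0_iff2 mult_minus1 mult_minus1_right)
    have "0 \<le> cos (Im z / 2)" using z by (intro cos_ge_zero) (auto simp: abs_le_iff)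
    then have "0 \<le> Re w" by (simp add: w_def Re_exp)
    then have "0 \<le> Re (1 / (1 + w))" by (simp add: Re_divide)
    moreover have "1 / (1 - w * w) = (1 / 2) / (1 - w) + (1 / 2) / (1 + w)"
    proof -
      have "1 - w \<noteq> 0" using w1 by simp
      then have "(1 / 2) / (1 - w) + (1 / 2) / (1 + w) = (1 / 2 * (1 + w) + 1 / 2 * (1 - w)) / ((1 - w) * (1 + w))"
        using w2 by (rule add_frac_eq)
      also have "1 / 2 * (1 + w) + 1 / 2 * (1 - w) = 1" by (simp add: field_simps)
      also have "(1 - w) * (1 + w) = 1 - w * w" by (simp add: algebra_simps)
      finally show ?thesis by simp
    qed
    then have "1 / (1 - exp z) = F (1/2) + of_real (1/2) * (1 / (1 + w))"
      by (simp add: w[symmetric] F_def w_def[symmetric] mult.commute)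
    then have "Re (1 / (1 - exp z)) = Re (F (1/2)) + 1/2 * Re (1 / (1 + w))"
      by (simp only: plus_complex.sel Re_complex_of_real Im_complex_of_real times_complex.sel)
    ultimately show ?thesis by linarith
  qed
  finally show ?thesis by (simp add: F_def)
qed

section \<open>Circle means and the functional calculus\<close>

lemma norm_vector_scalar_mult: "norm (a *s v) = cmod a * norm v" for v :: "complex ^ 'n"
  by (simp add: norm_vec_def L2_set_def norm_mult power_mult_distrib real_sqrt_mult flip: sum_distrib_left)

lemma bounded_bilinear_vector_scalar_mult:
  "bounded_bilinear ((*s) :: complex \<Rightarrow> complex ^ 'n \<Rightarrow> complex ^ 'n)"
  by (rule bounded_bilinear.intro)
    (auto simp: norm_vector_scalar_mult vec_eq_iff algebra_simps intro!: exI[of _ 1])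

lemmas continuous_on_vector_scalar_mult [continuous_intros] =
  bounded_bilinear.continuous_on[OF bounded_bilinear_vector_scalar_mult]

lemma bounded_linear_matrix_vector_mult: "bounded_linear ((*v) A)" for A :: "complex ^ 'n ^ 'm"
  by (rule matrix_vector_mul_bounded_linear)

lemma cinner_add_left: "cinner (x + y) z = cinner x z + cinner y z"
  by (simp add: cinner_def algebra_simps sum.distrib)

lemma cinner_diff_left: "cinner (x - y) z = cinner x z - cinner y z"
  by (simp add: cinner_def algebra_simps sum_subtractf)

lemma cinner_diff_right: "cinner z (x - y) = cinner z x - cinner z y"
  by (simp add: cinner_def algebra_simps sum_subtractf)

lemma cinner_scale_left: "cinner (a *s x) y = a * cinner x y"
  by (simp add: cinner_def algebra_simps sum_distrib_left)

lemma cinner_scale_right: "cinner x (a *s y) = cnj a * cinner x y"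
  by (simp add: cinner_def algebra_simps sum_distrib_left)

lemma Re_cinner: "Re (cinner x y) = x \<bullet> y"
  by (simp add: cinner_def inner_vec_def inner_complex_def)

lemma cinner_commute: "cinner x y = cnj (cinner y x)"
  by (simp add: cinner_def mult.commute)

lemma bounded_linear_cinner_left: "bounded_linear (\<lambda>x. cinner x y)"
  unfolding cinner_def
  by (intro bounded_linear_sum bounded_linear_mult_const bounded_linear_vec_nth)

lemma mat_vector_mult: "mat c *v v = c *s v" for v :: "complex ^ 'n"
  by (simp add: matrix_vector_mult_def mat_def vec_eq_iff if_distrib if_distribR cong: if_cong)

section \<open>Averages over circles\<close>

definition circle_mean :: "complex \<Rightarrow> real \<Rightarrow> (complex \<Rightarrow> 'a::real_normed_vector) \<Rightarrow> 'a" where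
  "circle_mean c r f = integral {0..1} (\<lambda>s. f (circlepath c r s))"

lemma continuous_on_circlepath:
  assumes "continuous_on (sphere c r) f" "0 < r"
  shows "continuous_on {0..1} (\<lambda>s. f (circlepath c r s))"
proof (rule continuous_on_compose2[OF assms(1)])
  show "continuous_on {0..1} (circlepath c r)"
    using path_def by (metis path_circlepath)
  show "circlepath c r ` {0..1} \<subseteq> sphere c r"
    using assms(2) by (metis abs_of_pos order_refl path_image_circlepath path_image_def)
qed

lemma circle_mean_integrable:
  fixes f :: "complex \<Rightarrow> 'a::banach"
  assumes "continuous_on (sphere c r) f" "0 < r"
  shows "(\<lambda>s. f (circlepath c r s)) integrable_on {0..1}"
  by (intro integrable_continuous_interval continuous_on_circlepath assms)

lemma circlepath_in_sphere: "0 < r \<Longrightarrow> s \<in> {0..1} \<Longrightarrow> circlepath c r s \<in> sphere c r"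
  by (metis abs_of_pos imageI path_image_circlepath path_image_def)

lemma circle_mean_cong:
  assumes "\<And>z. z \<in> sphere c r \<Longrightarrow> f z = g z" "0 < r"
  shows "circle_mean c r f = circle_mean c r g"
  unfolding circle_mean_def using assms by (intro integral_cong) (simp add: circlepath_in_sphere del: mem_sphere)

lemma circle_mean_add:
  fixes f g :: "complex \<Rightarrow> 'a::banach"
  assumes "continuous_on (sphere c r) f" "continuous_on (sphere c r) g" "0 < r"
  shows "circle_mean c r (\<lambda>z. f z + g z) = circle_mean c r f + circle_mean c r g"
  unfolding circle_mean_def by (intro integral_add circle_mean_integrable assms)

lemma circle_mean_linear:
  fixes f :: "complex \<Rightarrow> 'a::banach" and h :: "'a \<Rightarrow> 'b::banach"
  assumes "bounded_linear h" "continuous_on (sphere c r) f" "0 < r"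
  shows "circle_mean c r (\<lambda>z. h (f z)) = h (circle_mean c r f)"
  unfolding circle_mean_def
  using integral_linear[OF circle_mean_integrable[OF assms(2,3)] assms(1)] by (simp add: o_def)

lemma circle_mean_const [simp]: "circle_mean c r (\<lambda>_. k) = k"
  by (simp add: circle_mean_def)

lemma circle_mean_nonneg:
  fixes f :: "complex \<Rightarrow> real"
  assumes "continuous_on (sphere c r) f" "0 < r" "\<And>z. z \<in> sphere c r \<Longrightarrow> 0 \<le> f z"
  shows "0 \<le> circle_mean c r f"
  unfolding circle_mean_def using assms
  by (intro integral_nonneg circle_mean_integrable) (simp_all add: circlepath_in_sphere del: mem_sphere)

lemma norm_circle_mean_le:
  fixes f :: "complex \<Rightarrow> 'a::banach"
  assumes "continuous_on (sphere c r) f" "0 < r" "\<And>z. z \<in> sphere c r \<Longrightarrow> norm (f z) \<le> B"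
  shows "norm (circle_mean c r f) \<le> B"
  unfolding circle_mean_def
  using integral_bound[OF _ continuous_on_circlepath[OF assms(1,2)], of B] assms
  by (simp add: circlepath_in_sphere del: mem_sphere)

lemma circle_mean_uniform_limit:
  fixes f :: "nat \<Rightarrow> complex \<Rightarrow> 'a::banach"
  assumes "uniform_limit (sphere c r) f g sequentially" "\<And>n. continuous_on (sphere c r) (f n)" "0 < r"
  shows "(\<lambda>n. circle_mean c r (f n)) \<longlonglongrightarrow> circle_mean c r g"
proof -
  have "uniform_limit {0..1} (\<lambda>n s. f n (circlepath c r s)) (\<lambda>s. g (circlepath c r s)) sequentially"
    using assms(1,3) circlepath_in_sphere[OF assms(3), of _ c]
    unfolding uniform_limit_iff by (fastforce elim!: eventually_mono simp del: mem_sphere)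
  from uniform_limit_integral[OF this continuous_on_circlepath[OF assms(2,3)]]
  obtain I J where IJ: "\<And>n. ((\<lambda>s. f n (circlepath c r s)) has_integral I n) {0..1}"
    "((\<lambda>s. g (circlepath c r s)) has_integral J) {0..1}" "I \<longlonglongrightarrow> J" by auto
  then have "I = (\<lambda>n. integral {0..1} (\<lambda>s. f n (circlepath c r s)))"
    by (metis (no_types, lifting) IJ(1) integral_unique ext)
  with IJ show ?thesis by (simp add: circle_mean_def integral_unique)
qed

text \<open>On the circle \<open>dz = 2 pi i (z - c) ds\<close>, where \<open>s\<close> runs over
  [0,1], so the mean needs no normalising factor.\<close>

lemma contour_integral_circlepath_eq_mean:
  assumes "continuous_on (sphere c r) f" "0 < r"
  shows "contour_integral (circlepath c r) f = 2 * of_real pi * \<i> * circle_mean c r (\<lambda>z. f z * (z - c))"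
proof -
  have "contour_integral (circlepath c r) f
      = integral {0..1} (\<lambda>s. 2 * of_real pi * \<i> * (f (circlepath c r s) * (circlepath c r s - c)))"
    unfolding contour_integral_integral
    unfolding vector_derivative_circlepath by (simp add: circlepath mult_ac)
  also have "\<dots> = circle_mean c r (\<lambda>z. 2 * of_real pi * \<i> * (f z * (z - c)))"
    by (simp add: circle_mean_def)
  also have "\<dots> = 2 * of_real pi * \<i> * circle_mean c r (\<lambda>z. f z * (z - c))"
    using assms by (intro circle_mean_linear bounded_linear_mult_right continuous_intros)
  finally show ?thesis .
qed

text \<open>The mean value property: Cauchy's integral formula at the centre, whose kernel
  \<open>1 / (z - c)\<close> cancels the factor from \<open>dz\<close>.\<close>

lemma circle_mean_holomorphic:
  assumes "f holomorphic_on cball c r" "0 < r"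
  shows "circle_mean c r f = f c"
proof -
  have f: "continuous_on (sphere c r) f"
    using assms(1) holomorphic_on_imp_continuous_on continuous_on_subset sphere_cball by blast
  have "contour_integral (circlepath c r) (\<lambda>z. f z / (z - c)) = 2 * of_real pi * \<i> * f c"
    using Cauchy_integral_circlepath_simple[OF assms(1), of c] assms(2) by (simp add: contour_integral_unique)
  moreover have "contour_integral (circlepath c r) (\<lambda>z. f z / (z - c))
      = 2 * of_real pi * \<i> * circle_mean c r (\<lambda>z. f z / (z - c) * (z - c))"
    using assms f by (intro contour_integral_circlepath_eq_mean continuous_intros) auto
  moreover have "circle_mean c r (\<lambda>z. f z / (z - c) * (z - c)) = circle_mean c r f"
    using assms by (intro circle_mean_cong) auto
  ultimately show ?thesis by simp
qed

text \<open>On the circle \<open>1 / (z - c)\<close> equals \<open>cnj (z - c) / r^2\<close>, so for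
  \<open>k > 0\<close> the mean is the conjugate of the mean of a polynomial vanishing at
  \<open>c\<close>.\<close>

lemma circle_mean_inverse_power:
  assumes "0 < r"
  shows "circle_mean c r (\<lambda>z. 1 / (z - c) ^ k) = (if k = 0 then 1 else 0)"
proof (cases k)
  case (Suc n)
  have "circle_mean c r (\<lambda>z. 1 / (z - c) ^ k) = circle_mean c r (\<lambda>z. cnj (((z - c) / of_real (r\<^sup>2)) ^ k))"
  proof (rule circle_mean_cong[OF _ assms])
    fix z assume "z \<in> sphere c r"
    then have "cmod (z - c) = r" by (simp add: dist_norm norm_minus_commute)
    then have "(z - c) * cnj (z - c) = of_real (r\<^sup>2)" using complex_norm_square[of "z - c"] by simp
    moreover then have "z \<noteq> c" using assms by auto
    ultimately have "1 / (z - c) = cnj (z - c) / of_real (r\<^sup>2)" using assms by (simp add: field_simps)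
    then have "(1 / (z - c)) ^ k = (cnj (z - c) / of_real (r\<^sup>2)) ^ k" by simp
    then show "1 / (z - c) ^ k = cnj (((z - c) / of_real (r\<^sup>2)) ^ k)"
      by (simp add: power_one_over del: of_real_power)
  qed
  also have "\<dots> = cnj (circle_mean c r (\<lambda>z. ((z - c) / of_real (r\<^sup>2)) ^ k))"
    using assms by (intro circle_mean_linear bounded_linear_cnj continuous_intros) auto
  also have "circle_mean c r (\<lambda>z. ((z - c) / of_real (r\<^sup>2)) ^ k) = ((c - c) / of_real (r\<^sup>2)) ^ k"
    using assms by (intro circle_mean_holomorphic holomorphic_intros) auto
  finally show ?thesis using Suc by simp
qed simp

lemma uniform_limit_Taylor:
  assumes f: "f holomorphic_on ball c R" and r: "0 < r" "r < R"
  shows "uniform_limit (cball c r) (\<lambda>n z. \<Sum>i<n. (deriv ^^ i) f c / fact i * (z - c) ^ i) f sequentially"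
proof -
  define a where "a i = (deriv ^^ i) f c / fact i" for i
  have sums: "(\<lambda>i. a i * (z - c) ^ i) sums f z" if "z \<in> ball c R" for z
    unfolding a_def by (rule holomorphic_power_series[OF f that])
  \<comment> \<open>Convergence of the power series at an intermediate radius \<open>s\<close> gives
    absolute convergence at radius \<open>r\<close>, hence a majorant for the Weierstrass
    test.\<close>
  obtain s where s: "r < s" "s < R" using dense[OF r(2)] by blast
  have "summable (\<lambda>i. a i * of_real s ^ i)"
    using sums[of "c + of_real s"] s r by (auto simp: dist_norm sums_iff)
  then have "summable (\<lambda>i. norm (a i * of_real r ^ i))"
    by (rule powser_insidea) (use s r in simp)
  then have m: "summable (\<lambda>i. norm (a i) * r ^ i)" using r by (simp add: norm_mult norm_power)
  have "uniform_limit (cball c r) (\<lambda>n z. \<Sum>i<n. a i * (z - c) ^ i) (\<lambda>z. \<Sum>i. a i * (z - c) ^ i) sequentially"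
  proof (rule Weierstrass_m_test[OF _ m])
    fix n z assume "z \<in> cball c r"
    then have "cmod (z - c) \<le> r" by (simp add: dist_norm norm_minus_commute)
    then show "norm (a n * (z - c) ^ n) \<le> norm (a n) * r ^ n"
      by (auto simp: norm_mult norm_power intro!: mult_left_mono power_mono)
  qed
  moreover have "(\<Sum>i. a i * (z - c) ^ i) = f z" if "z \<in> cball c r" for z
    using sums[of z] that r by (simp add: sums_iff)
  ultimately show ?thesis unfolding a_def
    by (auto intro: uniform_limit_cong'[THEN iffD1, rotated 2])
qed

section \<open>Resolvents and the functional calculus on a circle\<close>

lemma matrix_inv_inverse:
  assumes "invertible A"
  shows "A ** matrix_inv A = mat 1" "matrix_inv A ** A = mat 1"
  using someI_ex[OF assms[unfolded invertible_def]] by (simp_all add: matrix_inv_def)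

text \<open>By Cramer's rule an entry of the resolvent is a quotient of two determinants, both
  polynomial in \<open>z\<close>, with nonvanishing denominator on the resolvent set.\<close>

lemma holomorphic_resolvent_entry:
  "(\<lambda>z. matrix_inv (mat z - A) $ i $ j) holomorphic_on resolvent_set A"
proof -
  have det: "det (mat z - A) \<noteq> 0" if "z \<in> resolvent_set A" for z
    using that by (simp add: resolvent_set_def invertible_det_nz)
  have "matrix_inv (mat z - A) $ i $ j
      = det (\<chi> k l. if l = i then axis j 1 $ k else (mat z - A) $ k $ l) / det (mat z - A)"
    if z: "z \<in> resolvent_set A" for z
  proof -
    have "(mat z - A) *v (matrix_inv (mat z - A) *v axis j 1) = axis j 1"
      using z matrix_inv_inverse(1)[of "mat z - A"] by (simp add: resolvent_set_def matrix_vector_mul_assoc)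
    then have "matrix_inv (mat z - A) *v axis j 1
        = (\<chi> k'. det (\<chi> k l. if l = k' then axis j 1 $ k else (mat z - A) $ k $ l) / det (mat z - A))"
      by (subst (asm) cramer[OF det[OF z]])
    then have "(matrix_inv (mat z - A) *v axis j 1) $ i
        = det (\<chi> k l. if l = i then axis j 1 $ k else (mat z - A) $ k $ l) / det (mat z - A)"
      by simp
    moreover have "(matrix_inv (mat z - A) *v axis j 1) $ i = matrix_inv (mat z - A) $ i $ j"
      by (simp add: matrix_vector_mult_def axis_def if_distrib cong: if_cong)
    ultimately show ?thesis by simp
  qed
  moreover have "(\<lambda>z. det (\<chi> k l. if l = i then axis j 1 $ k else (mat z - A) $ k $ l) / det (mat z - A))
      holomorphic_on resolvent_set A"
  proof (intro holomorphic_on_divide det)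
    have e: "(\<lambda>z. (mat z - A) $ k $ l) holomorphic_on S" for k l S
      by (cases "k = l") (auto simp: mat_def intro!: holomorphic_intros)
    show "(\<lambda>z. det (mat z - A)) holomorphic_on resolvent_set A"
      unfolding det_def by (intro holomorphic_intros e)
    have e': "(\<lambda>z. if b then a else (mat z - A) $ k $ l) holomorphic_on S" for k l S a b
      using e by (cases b) auto
    show "(\<lambda>z. det (\<chi> k l. if l = i then axis j 1 $ k else (mat z - A) $ k $ l)) holomorphic_on resolvent_set A"
      unfolding det_def by (simp only: vec_lambda_beta) (intro holomorphic_intros e')
  qed
  ultimately show ?thesis by (simp cong: holomorphic_cong)
qed

text \<open>The operator norm of \<open>A - c I\<close> is at most \<open>q < r\<close>. Hence the
  spectrum lies strictly inside the circle, and \<open>(A - c I) / r\<close> is a contraction, as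
  the von Neumann type inequality requires.\<close>

locale resolvent_circle =
  fixes A :: "complex ^ 'n ^ 'n" and c :: complex and q r :: real
  assumes q: "0 \<le> q" and qr: "q < r"
    and deviation: "norm (A *v v - c *s v) \<le> q * norm v"
begin

definition T :: "complex ^ 'n ^ 'n" where "T = A - mat c"

lemma T_vec: "T *v v = A *v v - c *s v"
  by (simp add: T_def matrix_vector_mult_diff_rdistrib mat_vector_mult)

lemma r: "0 < r"
  using q qr by simp

lemma norm_T: "norm (T *v v) \<le> q * norm v"
  by (simp add: T_vec deviation)

lemma eigenvalue_near:
  assumes "eigenvalue A z"
  shows "cmod (z - c) \<le> q"
proof -
  from assms obtain v where v: "v \<noteq> 0" "A *v v = z *s v" by (auto simp: eigenvalue_def)
  have "A *v v - c *s v = (z - c) *s v" by (simp add: v(2) vec_eq_iff algebra_simps)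
  then have "cmod (z - c) * norm v \<le> q * norm v"
    using deviation[of v] by (simp only: norm_vector_scalar_mult)
  with v(1) show ?thesis by simp
qed

lemma sphere_resolvent_set: "sphere c r \<subseteq> resolvent_set A"
proof
  fix z assume "z \<in> sphere c r"
  then have "q < cmod (z - c)" using qr by (simp add: dist_norm norm_minus_commute)
  then show "z \<in> resolvent_set A"
    using eigenvalue_near[of z] by (intro not_eigenvalue_imp_resolvent_set) auto
qed

text \<open>The factor \<open>z - c\<close> is the one from \<open>dz\<close>, so that means of
  \<open>f z *s rho v z\<close> are normalised contour integrals against the resolvent.\<close>

definition rho :: "complex ^ 'n \<Rightarrow> complex \<Rightarrow> complex ^ 'n" where
  "rho v z = (z - c) *s (matrix_inv (mat z - A) *v v)"

text \<open>The resolvent equation \<open>rho = v + T rho / (z - c)\<close>, multiplied out to avoid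
  the division.\<close>

lemma rho_eq:
  assumes "z \<in> sphere c r"
  shows "(z - c) *s rho v z = (z - c) *s v + T *v rho v z"
proof -
  define w where "w = matrix_inv (mat z - A) *v v"
  have "(mat z - A) *v w = v"
    using sphere_resolvent_set assms matrix_inv_inverse(1)[of "mat z - A"]
    by (auto simp: w_def matrix_vector_mul_assoc resolvent_set_def)
  then have eq: "v + (A *v w - c *s w) = (z - c) *s w"
    by (simp add: matrix_vector_mult_diff_rdistrib mat_vector_mult vec_eq_iff algebra_simps)
  have "(z - c) *s ((z - c) *s w) = (z - c) *s (v + T *v w)" by (simp only: T_vec eq)
  also have "\<dots> = (z - c) *s v + T *v ((z - c) *s w)"
    by (simp only: vector_scalar_commute vector_add_ldistrib)
  finally show ?thesis by (simp add: rho_def w_def)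
qed

lemma continuous_on_rho [continuous_intros]: "continuous_on (sphere c r) (rho v)"
proof -
  have inv: "continuous_on (sphere c r) (\<lambda>z. matrix_inv (mat z - A) $ i $ j)" for i j
    by (rule continuous_on_subset[OF holomorphic_on_imp_continuous_on[OF holomorphic_resolvent_entry]
        sphere_resolvent_set])
  show ?thesis
    unfolding rho_def matrix_vector_mult_def
    by (intro continuous_on_vector_scalar_mult continuous_on_vec_lambda continuous_on_sum continuous_on_mult
        continuous_on_diff continuous_on_id continuous_on_const inv)
qed

text \<open>The holomorphic functional calculus: the mean equals
  \<open>1/(2\<pi>i)\<close> times the contour integral of \<open>f(z) (z - A)\<^sup>-\<^sup>1 v\<close>.\<close>
definition fcalc :: "(complex \<Rightarrow> complex) \<Rightarrow> complex ^ 'n \<Rightarrow> complex ^ 'n" where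
  "fcalc f v = circle_mean c r (\<lambda>z. f z *s rho v z)"

lemma fcalc_add:
  assumes "continuous_on (sphere c r) f" "continuous_on (sphere c r) g"
  shows "fcalc (\<lambda>z. f z + g z) v = fcalc f v + fcalc g v"
  unfolding fcalc_def
  by (subst circle_mean_add[symmetric])
    (auto intro!: continuous_intros assms r circle_mean_cong simp: vec_eq_iff algebra_simps)

lemma fcalc_scale:
  assumes "continuous_on (sphere c r) f"
  shows "fcalc (\<lambda>z. a * f z) v = a *s fcalc f v"
proof -
  have "circle_mean c r (\<lambda>z. a *s (f z *s rho v z)) = a *s circle_mean c r (\<lambda>z. f z *s rho v z)"
    by (intro circle_mean_linear bounded_bilinear.bounded_linear_right[OF bounded_bilinear_vector_scalar_mult]
        continuous_intros assms r)
  then show ?thesis by (simp add: fcalc_def vector_smult_assoc)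
qed

lemma fcalc_sum:
  assumes "\<And>i. i \<in> I \<Longrightarrow> continuous_on (sphere c r) (f i)"
  shows "fcalc (\<lambda>z. \<Sum>i\<in>I. f i z) v = (\<Sum>i\<in>I. fcalc (f i) v)"
  using assms
proof (induction I rule: infinite_finite_induct)
  case (insert i I)
  then show ?case by (simp add: fcalc_add continuous_on_sum)
qed (simp_all add: fcalc_def)

text \<open>Insert \<open>rho_eq\<close> under the mean and pull \<open>T\<close> out by linearity.
  The scalar mean stays in the formula so that it applies to negative powers of \<open>z - c\<close>
  as well as to holomorphic \<open>f\<close>.\<close>

lemma fcalc_shift_mean:
  assumes f: "continuous_on (sphere c r) f"
  shows "fcalc (\<lambda>z. (z - c) * f z) v = circle_mean c r (\<lambda>z. (z - c) * f z) *s v + T *v fcalc f v"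
proof -
  have "fcalc (\<lambda>z. (z - c) * f z) v = circle_mean c r (\<lambda>z. ((z - c) * f z) *s v + T *v (f z *s rho v z))"
    unfolding fcalc_def
  proof (intro circle_mean_cong r)
    fix z assume z: "z \<in> sphere c r"
    have "((z - c) * f z) *s rho v z = f z *s ((z - c) *s rho v z)"
      by (simp only: vector_smult_assoc mult.commute)
    also have "\<dots> = f z *s ((z - c) *s v) + f z *s (T *v rho v z)"
      by (subst rho_eq[OF z]) (simp add: vec_eq_iff algebra_simps)
    finally show "((z - c) * f z) *s rho v z = ((z - c) * f z) *s v + T *v (f z *s rho v z)"
      by (simp only: vector_scalar_commute vector_smult_assoc mult.commute)
  qed
  also have "\<dots> = circle_mean c r (\<lambda>z. ((z - c) * f z) *s v) + circle_mean c r (\<lambda>z. T *v (f z *s rho v z))"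
    by (intro circle_mean_add continuous_intros f r
        bounded_linear.continuous_on[OF bounded_linear_matrix_vector_mult])
  also have "circle_mean c r (\<lambda>z. T *v (f z *s rho v z)) = T *v fcalc f v"
    unfolding fcalc_def by (intro circle_mean_linear bounded_linear_matrix_vector_mult continuous_intros f r)
  also have "circle_mean c r (\<lambda>z. ((z - c) * f z) *s v) = circle_mean c r (\<lambda>z. (z - c) * f z) *s v"
    by (intro circle_mean_linear bounded_bilinear.bounded_linear_left[OF bounded_bilinear_vector_scalar_mult]
        continuous_intros f r)
  finally show ?thesis .
qed

lemma continuous_on_inverse_power [continuous_intros]:
  "continuous_on (sphere c r) (\<lambda>z. 1 / (z - c) ^ k)"
  using r by (intro continuous_intros) auto

text \<open>The recursion \<open>m k = T (m (k + 1))\<close> for \<open>k > 0\<close> together with \<open>m k = O(r\<^sup>-\<^sup>k)\<close> and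
  \<open>\<parallel>T\<parallel> \<le> q < r\<close> forces the moments \<open>m k\<close> with \<open>k > 0\<close> to vanish.\<close>
lemma fcalc_inverse_power: "fcalc (\<lambda>z. 1 / (z - c) ^ k) v = (if k = 0 then v else 0)"
proof -
  define m where "m k = fcalc (\<lambda>z. 1 / (z - c) ^ k) v" for k
  have rec: "m k = (if k = 0 then v else 0) + T *v m (Suc k)" for k
  proof -
    have *: "(z - c) * (1 / (z - c) ^ Suc k) = 1 / (z - c) ^ k" if "z \<in> sphere c r" for z
      using that r by auto
    have "m k = fcalc (\<lambda>z. (z - c) * (1 / (z - c) ^ Suc k)) v"
      unfolding m_def fcalc_def by (intro circle_mean_cong r) (simp only: *)
    also have "\<dots> = circle_mean c r (\<lambda>z. (z - c) * (1 / (z - c) ^ Suc k)) *s v + T *v m (Suc k)"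
      unfolding m_def by (intro fcalc_shift_mean continuous_on_inverse_power)
    also have "circle_mean c r (\<lambda>z. (z - c) * (1 / (z - c) ^ Suc k)) = circle_mean c r (\<lambda>z. 1 / (z - c) ^ k)"
      by (intro circle_mean_cong r *)
    finally show ?thesis by (simp add: circle_mean_inverse_power[OF r])
  qed
  have "bounded (rho v ` sphere c r)"
    by (intro compact_imp_bounded compact_continuous_image continuous_intros) simp
  then obtain B where B: "\<forall>z\<in>sphere c r. norm (rho v z) \<le> B" by (auto simp: bounded_iff)
  have m_bound: "norm (m k) \<le> B / r ^ k" for k
    unfolding m_def fcalc_def
  proof (intro norm_circle_mean_le continuous_on_vector_scalar_mult continuous_on_inverse_power continuous_on_rho r)
    fix z assume z: "z \<in> sphere c r"
    then have "cmod (z - c) = r" by (simp add: dist_norm norm_minus_commute)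
    then show "norm (1 / (z - c) ^ k *s rho v z) \<le> B / r ^ k"
      using B z r by (simp add: norm_vector_scalar_mult norm_divide norm_power divide_right_mono)
  qed
  have zero: "m (Suc k) = 0" for k
  proof -
    have "norm (m (Suc k)) \<le> q ^ j * norm (m (Suc k + j))" for j
    proof (induction j)
      case (Suc j)
      have "norm (m (Suc k + j)) \<le> q * norm (m (Suc k + Suc j))"
        using rec[of "Suc k + j"] norm_T[of "m (Suc k + Suc j)"] by simp
      then have "q ^ j * norm (m (Suc k + j)) \<le> q ^ j * (q * norm (m (Suc k + Suc j)))"
        using q by (intro mult_left_mono) auto
      with Suc show ?case by (simp add: mult_ac)
    qed simp
    also have "q ^ j * norm (m (Suc k + j)) \<le> q ^ j * (B / r ^ (Suc k + j))" for j
      using q by (intro mult_left_mono m_bound) auto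
    finally have *: "norm (m (Suc k)) \<le> (q / r) ^ j * (B / r ^ Suc k)" for j
      by (simp add: power_add power_divide field_simps)
    have "(\<lambda>j. (q / r) ^ j * (B / r ^ Suc k)) \<longlonglongrightarrow> 0 * (B / r ^ Suc k)"
      using q qr by (intro tendsto_mult LIMSEQ_realpow_zero tendsto_const) auto
    then have "norm (m (Suc k)) \<le> 0 * (B / r ^ Suc k)"
      by (rule LIMSEQ_le_const) (use * in blast)
    then show ?thesis by simp
  qed
  show ?thesis
    using rec[of k] zero[of k] zero[of "k - 1"] by (auto simp flip: m_def)
qed

lemma fcalc_one [simp]: "fcalc (\<lambda>_. 1) v = v"
  using fcalc_inverse_power[of 0 v] by simp

lemma fcalc_const: "fcalc (\<lambda>_. a) v = a *s v"
  using fcalc_scale[of "\<lambda>_. 1" a v] by simp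

lemma fcalc_shift:
  assumes "f holomorphic_on cball c r"
  shows "fcalc (\<lambda>z. (z - c) * f z) v = T *v fcalc f v"
proof -
  have "continuous_on (sphere c r) f"
    using assms holomorphic_on_imp_continuous_on continuous_on_subset sphere_cball by blast
  moreover have "circle_mean c r (\<lambda>z. (z - c) * f z) = (c - c) * f c"
    by (intro circle_mean_holomorphic holomorphic_intros assms r)
  ultimately show ?thesis by (simp add: fcalc_shift_mean)
qed

lemma fcalc_uniform_limit:
  assumes "uniform_limit (sphere c r) f g sequentially"
    and f: "\<And>n. continuous_on (sphere c r) (f n)"
  shows "(\<lambda>n. fcalc (f n) v) \<longlonglongrightarrow> fcalc g v"
  unfolding fcalc_def
proof (rule circle_mean_uniform_limit)
  have "continuous_on (sphere c r) g"
    by (rule uniform_limit_theorem[OF _ assms(1)]) (use f in auto)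
  then have "bounded (g ` sphere c r)"
    by (intro compact_imp_bounded compact_continuous_image) auto
  moreover have "bounded (rho v ` sphere c r)"
    by (intro compact_imp_bounded compact_continuous_image continuous_intros) simp
  ultimately show "uniform_limit (sphere c r) (\<lambda>n z. f n z *s rho v z) (\<lambda>z. g z *s rho v z) sequentially"
    by (intro bounded_bilinear.bounded_uniform_limit[OF bounded_bilinear_vector_scalar_mult] assms(1)
        uniform_limit_const)
  show "continuous_on (sphere c r) (\<lambda>z. f n z *s rho v z)" for n
    by (intro continuous_intros f)
qed (rule r)

text \<open>For a Taylor polynomial of \<open>f\<close>, repeated use of \<open>fcalc_shift\<close>
  turns each factor \<open>z - c\<close> into \<open>T\<close>. The general case is the limit, since
  the Taylor polynomials converge uniformly on a circle of radius \<open>r < R\<close>.\<close>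

lemma fcalc_mult:
  assumes f: "f holomorphic_on ball c R" and R: "r < R" and g: "g holomorphic_on cball c r"
  shows "fcalc (\<lambda>z. f z * g z) v = fcalc f (fcalc g v)"
proof -
  define a where "a i = (deriv ^^ i) f c / fact i" for i
  define p where "p n z = (\<Sum>i<n. a i * (z - c) ^ i)" for n z
  have gc: "continuous_on (sphere c r) g"
    using g holomorphic_on_imp_continuous_on continuous_on_subset sphere_cball by blast
  have pc: "continuous_on (sphere c r) (p n)" for n
    unfolding p_def by (intro continuous_intros)
  have lim: "uniform_limit (sphere c r) p f sequentially"
    using uniform_limit_on_subset[OF uniform_limit_Taylor[OF f r R] sphere_cball]
    by (simp add: p_def[abs_def] a_def)
  have pow: "fcalc (\<lambda>z. (z - c) ^ i * h z) w = (((*v) T) ^^ i) (fcalc h w)"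
    if "h holomorphic_on cball c r" for i h w
  proof (induction i)
    case (Suc i)
    have "fcalc (\<lambda>z. (z - c) * ((z - c) ^ i * h z)) w = T *v fcalc (\<lambda>z. (z - c) ^ i * h z) w"
      by (intro fcalc_shift holomorphic_intros that)
    with Suc show ?case by (simp add: mult.assoc)
  qed simp
  have step: "fcalc (\<lambda>z. p n z * h z) w = (\<Sum>i<n. a i *s (((*v) T) ^^ i) (fcalc h w))"
    if "h holomorphic_on cball c r" for h w n
  proof -
    have hc: "continuous_on (sphere c r) h"
      using that holomorphic_on_imp_continuous_on continuous_on_subset sphere_cball by blast
    have "fcalc (\<lambda>z. p n z * h z) w = fcalc (\<lambda>z. \<Sum>i<n. a i * ((z - c) ^ i * h z)) w"
      by (simp add: p_def sum_distrib_right mult.assoc)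
    also have "\<dots> = (\<Sum>i<n. fcalc (\<lambda>z. a i * ((z - c) ^ i * h z)) w)"
      by (intro fcalc_sum continuous_intros hc)
    also have "\<dots> = (\<Sum>i<n. a i *s fcalc (\<lambda>z. (z - c) ^ i * h z) w)"
      by (intro sum.cong refl fcalc_scale continuous_intros hc)
    finally show ?thesis by (simp add: pow[OF that])
  qed
  \<comment> \<open>Taking \<open>h = g\<close> on \<open>v\<close>, and \<open>h = 1\<close> on
    \<open>fcalc g v\<close>, yields the same polynomial in \<open>T\<close> applied to
    \<open>fcalc g v\<close>.\<close>
  have eq: "fcalc (\<lambda>z. p n z * g z) v = fcalc (p n) (fcalc g v)" for n
    using step[OF g, of n v] step[of "\<lambda>_. 1" n "fcalc g v"] by simp
  have "bounded (g ` sphere c r)"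
    by (intro compact_imp_bounded compact_continuous_image gc) simp
  moreover have "bounded (f ` sphere c r)"
    using f R by (intro compact_imp_bounded compact_continuous_image)
      (auto intro!: holomorphic_on_imp_continuous_on elim!: holomorphic_on_subset)
  ultimately have "uniform_limit (sphere c r) (\<lambda>n z. p n z * g z) (\<lambda>z. f z * g z) sequentially"
    by (intro bounded_bilinear.bounded_uniform_limit[OF bounded_bilinear_mult] lim uniform_limit_const)
  then have "(\<lambda>n. fcalc (\<lambda>z. p n z * g z) v) \<longlonglongrightarrow> fcalc (\<lambda>z. f z * g z) v"
    by (intro fcalc_uniform_limit continuous_intros pc gc)
  moreover have "(\<lambda>n. fcalc (p n) (fcalc g v)) \<longlonglongrightarrow> fcalc f (fcalc g v)"
    by (intro fcalc_uniform_limit lim pc)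
  ultimately show ?thesis unfolding eq by (rule LIMSEQ_unique)
qed

text \<open>On the circle, \<open>cnj (z - c) = r\<^sup>2 / (z - c)\<close>, so only the constant Taylor coefficient survives.\<close>
lemma fcalc_cnj:
  assumes f: "f holomorphic_on ball c R" and R: "r < R"
  shows "fcalc (\<lambda>z. cnj (f z)) v = cnj (f c) *s v"
proof -
  define a where "a i = (deriv ^^ i) f c / fact i" for i
  define p where "p n z = (\<Sum>i<n. a i * (z - c) ^ i)" for n z
  have pc: "continuous_on (sphere c r) (p n)" for n
    unfolding p_def by (intro continuous_intros)
  have lim: "uniform_limit (sphere c r) p f sequentially"
    using uniform_limit_on_subset[OF uniform_limit_Taylor[OF f r R] sphere_cball]
    by (simp add: p_def[abs_def] a_def)
  then have "uniform_limit (sphere c r) (\<lambda>n z. cnj (p n z)) (\<lambda>z. cnj (f z)) sequentially"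
    by (intro bounded_linear.uniform_limit[OF bounded_linear_cnj])
  then have "(\<lambda>n. fcalc (\<lambda>z. cnj (p n z)) v) \<longlonglongrightarrow> fcalc (\<lambda>z. cnj (f z)) v"
    by (intro fcalc_uniform_limit continuous_intros pc)
  \<comment> \<open>\<open>p 0\<close> is the empty sum; the constant coefficient is present from
    \<open>n = 1\<close> on.\<close>
  moreover have "fcalc (\<lambda>z. cnj (p n z)) v = cnj (f c) *s v" if n: "0 < n" for n
  proof -
    have "fcalc (\<lambda>z. cnj (p n z)) v = fcalc (\<lambda>z. \<Sum>i<n. (cnj (a i) * of_real (r\<^sup>2) ^ i) * (1 / (z - c) ^ i)) v"
      unfolding fcalc_def
    proof (intro circle_mean_cong r)
      fix z assume "z \<in> sphere c r"
      then have zr: "cmod (z - c) = r" by (simp add: dist_norm norm_minus_commute)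
      then have "(z - c) * cnj (z - c) = of_real (r\<^sup>2)" "z - c \<noteq> 0"
        using complex_norm_square[of "z - c"] r by auto
      then have "cnj (z - c) = of_real (r\<^sup>2) / (z - c)" by (simp add: field_simps)
      then have "cnj (z - c) ^ i = of_real (r\<^sup>2) ^ i * (1 / (z - c) ^ i)" for i
        by (simp add: power_divide del: complex_cnj_diff of_real_power)
      then show "cnj (p n z) *s rho v z
          = (\<Sum>i<n. (cnj (a i) * of_real (r\<^sup>2) ^ i) * (1 / (z - c) ^ i)) *s rho v z"
        unfolding p_def cnj_sum complex_cnj_mult complex_cnj_power by (simp add: mult.assoc)
    qed
    also have "\<dots> = (\<Sum>i<n. fcalc (\<lambda>z. (cnj (a i) * of_real (r\<^sup>2) ^ i) * (1 / (z - c) ^ i)) v)"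
      by (intro fcalc_sum continuous_on_mult_left continuous_on_inverse_power)
    also have "\<dots> = (\<Sum>i<n. (cnj (a i) * of_real (r\<^sup>2) ^ i) *s fcalc (\<lambda>z. 1 / (z - c) ^ i) v)"
      by (intro sum.cong refl fcalc_scale continuous_on_inverse_power)
    also have "\<dots> = (\<Sum>i<n. if i = 0 then cnj (f c) *s v else 0)"
      by (intro sum.cong) (auto simp: fcalc_inverse_power a_def)
    also have "\<dots> = cnj (f c) *s v" using n by simp
    finally show ?thesis .
  qed
  then have "(\<lambda>n. fcalc (\<lambda>z. cnj (p n z)) v) \<longlonglongrightarrow> cnj (f c) *s v"
    by (intro tendsto_eventually eventually_sequentiallyI[of 1]) simp
  ultimately show ?thesis by (rule LIMSEQ_unique)
qed

text \<open>Positivity of the operator Poisson kernel. With \<open>w = rho v z\<close> and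
  \<open>u = T w / (z - c)\<close> one has \<open>v = w - u\<close>, so twice the real part minus
  \<open>(norm v)^2\<close> equals \<open>(norm w)^2 - (norm u)^2\<close>, and \<open>u\<close> is
  no longer than \<open>w\<close>.\<close>

lemma Re_cinner_rho:
  assumes "z \<in> sphere c r"
  shows "(norm v)\<^sup>2 \<le> 2 * Re (cinner (rho v z) v)"
proof -
  define w where "w = rho v z"
  have zr: "cmod (z - c) = r" using assms by (simp add: dist_norm norm_minus_commute)
  define u where "u = (1 / (z - c)) *s (T *v w)"
  have "(z - c) *s (v + u) = (z - c) *s w"
    using rho_eq[OF assms, of v] zr r by (auto simp: u_def w_def vec_eq_iff algebra_simps)
  moreover have "z - c \<noteq> 0" using zr r by auto
  ultimately have "v + u = w" by (metis vector_mul_lcancel)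
  then have v: "v = w - u" by (simp add: eq_diff_eq)
  have "norm u = norm (T *v w) / r"
    by (simp add: u_def norm_vector_scalar_mult norm_divide zr)
  also have "\<dots> \<le> q * norm w / r" using r by (intro divide_right_mono norm_T) auto
  also have "\<dots> \<le> norm w"
    using q qr r by (simp add: field_simps mult_right_mono)
  finally have "(norm u)\<^sup>2 \<le> (norm w)\<^sup>2" by (intro power_mono) auto
  then have "(norm v)\<^sup>2 \<le> 2 * (w \<bullet> v)"
    unfolding v by (simp add: power2_norm_eq_inner inner_diff_left inner_diff_right inner_commute)
  then show ?thesis by (simp add: w_def Re_cinner)
qed

text \<open>The left side is the mean of \<open>Re (f z)\<close> against the Poisson kernel
  \<open>2 * Re (cinner (rho v z) v) - (norm v)^2\<close>, and both factors are nonnegative on the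
  circle.\<close>

lemma Re_fcalc_nonneg:
  assumes f: "f holomorphic_on ball c R" and R: "r < R"
    and nonneg: "\<And>z. z \<in> sphere c r \<Longrightarrow> 0 \<le> Re (f z)"
  shows "0 \<le> Re (cinner (fcalc f v) v)"
proof -
  have fh: "f holomorphic_on cball c r" using f R by (auto elim!: holomorphic_on_subset)
  then have fc: "continuous_on (sphere c r) f"
    using holomorphic_on_imp_continuous_on continuous_on_subset sphere_cball by blast
  have mean: "circle_mean c r (\<lambda>z. Re (f z)) = Re (f c)"
    using circle_mean_linear[OF bounded_linear_Re fc r] circle_mean_holomorphic[OF fh r] by simp
  have bl: "bounded_linear (\<lambda>x :: complex ^ 'n. Re (cinner x v))"
    by (rule bounded_linear_compose[OF bounded_linear_Re bounded_linear_cinner_left])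
  have cn: "continuous_on (sphere c r) (\<lambda>z. Re (cinner (rho v z) v))"
    by (intro bounded_linear.continuous_on[OF bl] continuous_intros)
  \<comment> \<open>Adding the conjugate of \<open>f\<close> makes the integrand's scalar factor
    real and changes the result only by the known multiple \<open>cnj (f c)\<close> of
    \<open>v\<close>.\<close>
  have "fcalc f v + cnj (f c) *s v = fcalc (\<lambda>z. f z + cnj (f z)) v"
    using fcalc_cnj[OF f R] fc by (simp add: fcalc_add continuous_on_cnj)
  also have "(\<lambda>z. f z + cnj (f z)) = (\<lambda>z. of_real (2 * Re (f z)))"
    by (simp add: complex_add_cnj)
  finally have "fcalc f v + cnj (f c) *s v = fcalc (\<lambda>z. of_real (2 * Re (f z))) v" .
  from arg_cong[OF this, of "\<lambda>x. Re (cinner x v)"]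
  have "Re (cinner (fcalc f v) v) + Re (f c) * (norm v)\<^sup>2
      = Re (cinner (fcalc (\<lambda>z. of_real (2 * Re (f z))) v) v)"
    by (simp add: cinner_add_left cinner_scale_left cinner_self del: of_real_power of_real_mult)
  also have "\<dots> = circle_mean c r (\<lambda>z. Re (cinner (of_real (2 * Re (f z)) *s rho v z) v))"
    unfolding fcalc_def by (intro circle_mean_linear[symmetric] bl continuous_intros fc r)
  finally have "Re (cinner (fcalc f v) v)
      = circle_mean c r (\<lambda>z. 2 * Re (f z) * Re (cinner (rho v z) v)) - Re (f c) * (norm v)\<^sup>2"
    by (simp add: cinner_scale_left)
  \<comment> \<open>The mean value property for \<open>Re f\<close> moves the correction term under
    the mean, where it completes the Poisson kernel.\<close>
  also have "Re (f c) * (norm v)\<^sup>2 = circle_mean c r (\<lambda>z. Re (f z) * (norm v)\<^sup>2)"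
    using circle_mean_linear[OF bounded_linear_mult_left, of c r "\<lambda>z. Re (f z)" "(norm v)\<^sup>2"] mean r fc
    by (simp add: continuous_on_Re)
  also have "circle_mean c r (\<lambda>z. 2 * Re (f z) * Re (cinner (rho v z) v)) - circle_mean c r (\<lambda>z. Re (f z) * (norm v)\<^sup>2)
      = circle_mean c r (\<lambda>z. Re (f z) * (2 * Re (cinner (rho v z) v) - (norm v)\<^sup>2))"
    unfolding circle_mean_def
    by (subst integral_diff[symmetric])
      (auto intro!: circle_mean_integrable continuous_intros fc cn r simp: algebra_simps)
  also have "\<dots> \<ge> 0"
    using Re_cinner_rho nonneg by (intro circle_mean_nonneg continuous_intros fc cn r mult_nonneg_nonneg) auto
  finally show ?thesis .
qed

text \<open>Connects \<open>fcalc\<close> with the entrywise contour integrals of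
  \<open>contour_power\<close>.\<close>

lemma fcalc_component:
  assumes f: "continuous_on (sphere c r) f"
  shows "fcalc f v $ i = (\<Sum>j\<in>UNIV. 1 / (2 * of_real pi * \<i>) *
      contour_integral (circlepath c r) (\<lambda>z. f z * matrix_inv (mat z - A) $ i $ j) * v $ j)"
proof -
  have inv: "continuous_on (sphere c r) (\<lambda>z. matrix_inv (mat z - A) $ i $ j)" for i j
    by (rule continuous_on_subset[OF holomorphic_on_imp_continuous_on[OF holomorphic_resolvent_entry]
        sphere_resolvent_set])
  have "fcalc f v $ i = circle_mean c r (\<lambda>z. (f z *s rho v z) $ i)"
    unfolding fcalc_def by (intro circle_mean_linear[symmetric] bounded_linear_vec_nth continuous_intros f r)
  also have "\<dots> = circle_mean c r (\<lambda>z. \<Sum>j\<in>UNIV. f z * matrix_inv (mat z - A) $ i $ j * (z - c) * v $ j)"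
    by (simp only: rho_def vector_smult_component matrix_vector_mult_def vec_lambda_beta sum_distrib_left mult_ac)
  also have "\<dots> = (\<Sum>j\<in>UNIV. circle_mean c r (\<lambda>z. f z * matrix_inv (mat z - A) $ i $ j * (z - c) * v $ j))"
    unfolding circle_mean_def
    by (intro integral_sum circle_mean_integrable continuous_intros f inv r) auto
  also have "\<dots> = (\<Sum>j\<in>UNIV. circle_mean c r (\<lambda>z. f z * matrix_inv (mat z - A) $ i $ j * (z - c)) * v $ j)"
    by (intro sum.cong refl circle_mean_linear bounded_linear_mult_left continuous_intros f inv r)
  also have "\<dots> = (\<Sum>j\<in>UNIV. 1 / (2 * of_real pi * \<i>) *
      contour_integral (circlepath c r) (\<lambda>z. f z * matrix_inv (mat z - A) $ i $ j) * v $ j)"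
    by (subst contour_integral_circlepath_eq_mean) (auto intro!: continuous_intros f inv r)
  finally show ?thesis .
qed

end

section \<open>Fractional powers of accretive matrices\<close>

lemma eigenvalue_imp_not_resolvent_set:
  assumes "eigenvalue A z"
  shows "z \<notin> resolvent_set A"
proof
  assume inv: "z \<in> resolvent_set A"
  from assms obtain v where v: "v \<noteq> 0" "A *v v = z *s v" by (auto simp: eigenvalue_def)
  then have "(mat z - A) *v v = 0" by (simp add: matrix_vector_mult_diff_rdistrib mat_vector_mult)
  then have "(matrix_inv (mat z - A) ** (mat z - A)) *v v = 0"
    by (simp flip: matrix_vector_mul_assoc)
  with v inv show False by (simp add: matrix_inv_inverse resolvent_set_def)
qed

text \<open>The eigenvalues are the zeros of the entire function \<open>det (mat z - A)\<close> and
  lie in the compact numerical range; a nonconstant entire function has finitely many zeros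
  there.\<close>

lemma finite_eigenvalues: "finite {z. eigenvalue A z}"
proof -
  define f where "f z = det (mat z - A)" for z
  have e: "(\<lambda>z. (mat z - A) $ k $ l) holomorphic_on UNIV" for k l
    by (cases "k = l") (auto simp: mat_def intro!: holomorphic_intros)
  have hol: "f holomorphic_on UNIV" unfolding f_def det_def by (intro holomorphic_intros e)
  have eig: "eigenvalue A z" if "f z = 0" for z
    using that not_eigenvalue_imp_resolvent_set[of A z]
    by (auto simp: f_def resolvent_set_def invertible_det_nz)
  have f0: "f z = 0" if "eigenvalue A z" for z
    using that eigenvalue_imp_not_resolvent_set[of A z]
    by (auto simp: f_def resolvent_set_def invertible_det_nz)
  have K: "{z. eigenvalue A z} \<subseteq> numerical_range A" by (auto intro: eigenvalue_in_numerical_range)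
  have eq: "{z. eigenvalue A z} = {z \<in> numerical_range A. f z = 0}" using K eig f0 by auto
  show ?thesis
  proof (cases "f constant_on UNIV")
    case True
    \<comment> \<open>A point outside the bounded numerical range is no eigenvalue, so a constant
      determinant would be a nonzero constant and there would be no eigenvalues.\<close>
    have "\<not> UNIV \<subseteq> numerical_range A"
      using compact_imp_bounded[OF compact_numerical_range[of A]] bounded_subset not_bounded_UNIV by blast
    then obtain w where "f w \<noteq> 0" using K eig by blast
    with True have "f z \<noteq> 0" for z by (auto simp: constant_on_def)
    then show ?thesis by (simp add: eq)
  next
    case False
    then show ?thesis
      unfolding eq by (intro holomorphic_compact_finite_zeros[OF hol] compact_numerical_range) auto
  qed
qed

text \<open>The residue theorem on the simply connected slit plane gives the same sum of residues at
  the eigenvalues for every admissible contour, as all winding numbers there are 1.\<close>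

lemma contour_power_unique:
  assumes "power_contour A \<gamma>" "power_contour A \<delta>"
  shows "contour_power \<gamma> A t = contour_power \<delta> A t"
proof -
  define S :: "complex set" where "S = - \<real>\<^sub>\<le>\<^sub>0"
  define E where "E = {z. eigenvalue A z}"
  have S: "open S" "simply_connected S"
  proof -
    have "(\<real>\<^sub>\<le>\<^sub>0 :: complex set) = of_real ` {..0}" by (auto simp: nonpos_Reals_def)
    then show "simply_connected S"
      using starlike_imp_simply_connected[OF starlike_slotted_complex_plane_left[of 0]] by (simp add: S_def)
  qed (simp add: S_def closed_nonpos_Reals_complex open_Compl)
  have not_E: "z \<notin> E" if "z \<in> resolvent_set A" for z
    using that eigenvalue_imp_not_resolvent_set by (auto simp: E_def)
  have *: "contour_integral \<gamma> (\<lambda>z. z powr of_real t * matrix_inv (mat z - A) $ i $ j)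
      = 2 * pi * \<i> * (\<Sum>p\<in>E. residue (\<lambda>z. z powr of_real t * matrix_inv (mat z - A) $ i $ j) p)"
    if "power_contour A \<gamma>" for \<gamma> i j
  proof -
    from that have \<gamma>: "valid_path \<gamma>" "pathfinish \<gamma> = pathstart \<gamma>" "path_image \<gamma> \<subseteq> resolvent_set A"
      "path_image \<gamma> \<inter> \<real>\<^sub>\<le>\<^sub>0 = {}" "\<And>z. z \<in> E \<Longrightarrow> winding_number \<gamma> z = 1"
      by (auto simp: power_contour_def E_def)
    have im: "path_image \<gamma> \<subseteq> S - E" using \<gamma> not_E by (auto simp: S_def)
    have "contour_integral \<gamma> (\<lambda>z. z powr of_real t * matrix_inv (mat z - A) $ i $ j)
        = 2 * pi * \<i> * (\<Sum>p\<in>E. winding_number \<gamma> p *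
            residue (\<lambda>z. z powr of_real t * matrix_inv (mat z - A) $ i $ j) p)"
    proof (rule Residue_theorem[OF S(1) _ _ _ \<gamma>(1,2) im])
      show "connected S" using S by (simp add: simply_connected_imp_connected)
      show "finite E" by (simp add: E_def finite_eigenvalues)
      have "S - E \<subseteq> resolvent_set A" using not_eigenvalue_imp_resolvent_set by (auto simp: E_def)
      then show "(\<lambda>z. z powr of_real t * matrix_inv (mat z - A) $ i $ j) holomorphic_on S - E"
        by (intro holomorphic_intros holomorphic_on_subset[OF holomorphic_resolvent_entry]) (auto simp: S_def)
      have "path_image \<gamma> \<subseteq> S" using im by blast
      then show "\<forall>z. z \<notin> S \<longrightarrow> winding_number \<gamma> z = 0"
        using simply_connected_imp_winding_number_zero[OF S(2) valid_path_imp_path[OF \<gamma>(1)]] \<gamma>(2) by auto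
    qed
    then show ?thesis using \<gamma>(5) by simp
  qed
  show ?thesis using assms by (simp add: contour_power_def *)
qed

text \<open>For large \<open>R\<close> the matrix is close to \<open>R I\<close>: in the expansion
  of \<open>(norm (A v - R v))^2\<close> the cross term \<open>- 2 R Re <A v, v>\<close> outweighs
  \<open>(norm (A v))^2\<close>. A circle about \<open>R\<close> of radius between \<open>q\<close>
  and \<open>R\<close> lies in the right half-plane.\<close>

lemma accretive_disc:
  assumes "accretive A"
  obtains q R :: real where "0 \<le> q" "q < R" "\<forall>v. norm (A *v v - of_real R *s v) \<le> q * norm v"
proof -
  have "continuous_on (numerical_range A) Re" by (intro continuous_intros)
  from continuous_attains_inf[OF compact_numerical_range numerical_range_nonempty this]
  obtain w where w: "w \<in> numerical_range A" "\<forall>y\<in>numerical_range A. Re w \<le> Re y" by blast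
  define m where "m = Re w"
  have m: "0 < m" using assms w by (auto simp: accretive_def m_def)
  have low: "m * (norm v)\<^sup>2 \<le> (A *v v) \<bullet> v" for v
  proof (cases "v = 0")
    case False
    define u where "u = (1 / norm v) *\<^sub>R v"
    have u: "norm u = 1" "v = norm v *\<^sub>R u" using False by (simp_all add: u_def)
    then have "m \<le> Re (cinner (A *v u) u)" using w by (auto simp: m_def numerical_range_def)
    then have "m * (norm v)\<^sup>2 \<le> (A *v u) \<bullet> u * (norm v)\<^sup>2" by (simp add: Re_cinner mult_right_mono)
    also have "(A *v u) \<bullet> u * (norm v)\<^sup>2 = (A *v v) \<bullet> v"
    proof -
      have Av: "A *v v = norm v *\<^sub>R (A *v u)"
        by (subst u(2)) (rule linear_scale[OF bounded_linear.linear[OF bounded_linear_matrix_vector_mult]])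
      have "(A *v v) \<bullet> v = (norm v *\<^sub>R (A *v u)) \<bullet> (norm v *\<^sub>R u)"
        by (simp only: Av u(2)[symmetric])
      then show ?thesis by (simp add: power2_eq_square)
    qed
    finally show ?thesis .
  qed simp
  obtain K where K: "0 < K" "\<And>v. norm (A *v v) \<le> norm v * K"
    using bounded_linear.pos_bounded[OF bounded_linear_matrix_vector_mult] by blast
  \<comment> \<open>\<open>m\<close> bounds the real part of the numerical range from below and
    \<open>K\<close> bounds the operator norm. This \<open>R\<close> satisfies
    \<open>K^2 <= R * m\<close> and \<open>m <= R\<close>; the latter makes the radicand of
    \<open>q\<close> nonnegative.\<close>
  define R where "R = K\<^sup>2 / m + m"
  define q where "q = sqrt (R\<^sup>2 - R * m)"
  have R: "m \<le> R" "K\<^sup>2 \<le> R * m" using m by (simp_all add: R_def field_simps)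
  have "R * m \<le> R * R" using R m by (intro mult_left_mono) auto
  then have q: "0 \<le> q" "q\<^sup>2 = R\<^sup>2 - R * m" by (simp_all add: q_def power2_eq_square)
  have "0 < R * m" using R m by simp
  then have qR: "q < R" using q(2) R m by (intro power2_less_imp_less[of q R]) linarith+
  show ?thesis
  proof (intro that[OF q(1) qR] allI)
    fix v
    have "(norm (A *v v - of_real R *s v))\<^sup>2 = (norm (A *v v))\<^sup>2 - 2 * R * ((A *v v) \<bullet> v) + R\<^sup>2 * (norm v)\<^sup>2"
    proof -
      have "of_real R *s v = R *\<^sub>R v" by (simp add: vec_eq_iff scaleR_conv_of_real[where 'a = complex])
      then show ?thesis
        by (simp only: power2_norm_eq_inner) (simp add: inner_diff_left inner_diff_right inner_commute power2_eq_square algebra_simps)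
    qed
    moreover have "(norm (A *v v))\<^sup>2 \<le> (norm v * K)\<^sup>2" using K by (intro power_mono) auto
    moreover have "(norm v * K)\<^sup>2 \<le> R * m * (norm v)\<^sup>2"
      using mult_right_mono[OF R(2), of "(norm v)\<^sup>2"] by (simp add: power_mult_distrib mult.commute)
    moreover have "R * (m * (norm v)\<^sup>2) \<le> R * ((A *v v) \<bullet> v)"
      using low[of v] R m by (intro mult_left_mono) auto
    moreover have "(q * norm v)\<^sup>2 = R\<^sup>2 * (norm v)\<^sup>2 - R * (m * (norm v)\<^sup>2)"
      by (simp add: q(2) power_mult_distrib algebra_simps)
    ultimately have "(norm (A *v v - of_real R *s v))\<^sup>2 \<le> (q * norm v)\<^sup>2" by simp
    then show "norm (A *v v - of_real R *s v) \<le> q * norm v"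
      by (rule power2_le_imp_le) (use q(1) in simp)
  qed
qed

text \<open>The circle stays in the right half-plane because \<open>r < R\<close>, so it is an
  admissible contour and may replace the arbitrarily chosen one.\<close>

lemma fractional_power_eq_fcalc:
  fixes R q r t :: real
  assumes A: "accretive A" and "resolvent_circle A (of_real R) q r" and "r < R"
  shows "fractional_power A t *v v = resolvent_circle.fcalc A (of_real R) r (\<lambda>z. z powr of_real t) v"
proof -
  interpret resolvent_circle A "of_real R" q r by fact
  have pos: "0 < Re z" if "z \<in> cball (of_real R) r" for z
    using that \<open>r < R\<close> abs_Re_le_cmod[of "of_real R - z"] by (simp add: dist_norm)
  have "power_contour A (circlepath (of_real R) r)"
    unfolding power_contour_def
  proof (intro conjI allI impI)
    show "path_image (circlepath (of_real R) r) \<subseteq> resolvent_set A"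
      using sphere_resolvent_set r by simp
    show "path_image (circlepath (of_real R) r) \<inter> \<real>\<^sub>\<le>\<^sub>0 = {}"
      using pos r by (force simp: complex_nonpos_Reals_iff)
    show "winding_number (circlepath (of_real R) r) z = 1" if "eigenvalue A z" for z
      using eigenvalue_near[OF that] qr by (intro winding_number_circlepath) auto
  qed auto
  moreover have "power_contour A (SOME \<gamma>. power_contour A \<gamma>)"
    using accretive_power_contour[OF A] by (rule someI_ex)
  ultimately have eq: "fractional_power A t = contour_power (circlepath (of_real R) r) A t"
    unfolding fractional_power_def by (intro contour_power_unique)
  have "(\<lambda>z :: complex. z powr of_real t) holomorphic_on sphere (of_real R) r"
    using pos by (intro holomorphic_intros) (force simp: complex_nonpos_Reals_iff)
  then have cont: "continuous_on (sphere (of_real R) r) (\<lambda>z :: complex. z powr of_real t)"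
    by (rule holomorphic_on_imp_continuous_on)
  show ?thesis
    by (simp add: vec_eq_iff eq contour_power_def fcalc_component[OF cont] matrix_vector_mult_def)
qed

section \<open>Splitting off the pole, and the conclusion\<close>

text \<open>The partial fraction of \<open>1 / (1 - a / a0)\<close> as a function of \<open>a powr t\<close>, at its only
  pole \<open>a0\<close> in the right half-plane; \<open>G\<close> is the remainder.\<close>
lemma power_partial_fraction:
  fixes a0 :: complex and t :: real
  assumes a0: "0 < Re a0" and t: "0 < t" "t \<le> 1 / 2"
  obtains p G where "p holomorphic_on {a. 0 < Re a}" "G holomorphic_on {a. 0 < Re a}"
    "\<forall>a. 0 < Re a \<longrightarrow> 1 - a / a0 = (1 - a powr of_real t / a0 powr of_real t) * p a"
    "\<forall>a. 0 < Re a \<longrightarrow> 1 - of_real t * p a = G a * (1 - a / a0)"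
    "\<forall>a. 0 < Re a \<longrightarrow> a \<noteq> a0 \<longrightarrow> 0 \<le> Re (G a)"
proof -
  define H where "H = {a. 0 < Re a}"
  have "open H" by (simp add: H_def open_halfspace_Re_gt)
  have a0H: "a0 \<in> interior H" using \<open>open H\<close> a0 by (simp add: interior_open H_def)
  have a00: "a0 \<noteq> 0" using a0 by auto
  have slit: "a \<notin> \<real>\<^sub>\<le>\<^sub>0" if "a \<in> H" for a using that by (auto simp: H_def complex_nonpos_Reals_iff)
  define f where "f a = 1 - a powr of_real t / a0 powr of_real t" for a
  \<comment> \<open>\<open>F\<close> is the difference quotient of \<open>f\<close> with its
    removable singularity filled in. So \<open>p\<close> extends \<open>(1 - a / a0) / f a\<close>
    holomorphically to \<open>a0\<close>, with value \<open>1 / t\<close>, which makes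
    \<open>N\<close> vanish at \<open>a0\<close> and lets \<open>G\<close> extend
    \<open>N a / (1 - a / a0)\<close>.\<close>
  define F where "F a = (if a = a0 then deriv f a0 else (f a - f a0) / (a - a0))" for a
  define p where "p a = - 1 / (a0 * F a)" for a
  define N where "N a = 1 - of_real t * p a" for a
  define G where "G a = - a0 * (if a = a0 then deriv N a0 else (N a - N a0) / (a - a0))" for a
  have f_hol: "f holomorphic_on H"
    unfolding f_def using slit a00 by (intro holomorphic_intros) auto
  have f_a0: "f a0 = 0" using a00 by (simp add: f_def)
  have "(f has_field_derivative (- (of_real t / a0))) (at a0)"
  proof -
    have "a0 powr (of_real t - 1) = a0 powr of_real t / a0" using a00 by (simp add: powr_diff)
    then show ?thesis
      unfolding f_def using a00 slit[of a0] a0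
      by (auto intro!: derivative_eq_intros has_field_derivative_powr simp: H_def)
  qed
  then have f': "deriv f a0 = - (of_real t / a0)" by (rule DERIV_imp_deriv)
  \<comment> \<open>A logarithm of \<open>a / a0\<close>; both arguments are below
    \<open>pi / 2\<close> in modulus, so its imaginary part is below \<open>pi\<close>.\<close>
  define \<zeta> where "\<zeta> a = Ln a - Ln a0" for a
  have zeta: "\<zeta> a \<noteq> 0" "\<bar>Im (\<zeta> a)\<bar> < pi" "exp (\<zeta> a) = a / a0" "f a = 1 - exp (of_real t * \<zeta> a)"
    if "a \<in> H" "a \<noteq> a0" for a
  proof -
    have a: "a \<noteq> 0" using that by (auto simp: H_def)
    show "\<zeta> a \<noteq> 0" using that a a00 by (metis \<zeta>_def eq_iff_diff_eq_0 exp_Ln)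
    have "\<bar>Im (Ln a)\<bar> < pi / 2" "\<bar>Im (Ln a0)\<bar> < pi / 2"
      using that a0 Re_Ln_pos_lt[OF a] Re_Ln_pos_lt[OF a00] by (simp_all add: H_def)
    then show "\<bar>Im (\<zeta> a)\<bar> < pi" by (simp add: \<zeta>_def)
    show "exp (\<zeta> a) = a / a0" using a a00 by (simp add: \<zeta>_def exp_diff)
    show "f a = 1 - exp (of_real t * \<zeta> a)"
      using a a00 by (simp add: f_def powr_def \<zeta>_def right_diff_distrib exp_diff)
  qed
  have f_nz: "f a \<noteq> 0" if "a \<in> H" "a \<noteq> a0" for a
  proof -
    have "t * \<bar>Im (\<zeta> a)\<bar> \<le> 1 * \<bar>Im (\<zeta> a)\<bar>" using t by (intro mult_right_mono) auto
    then have "\<bar>Im (of_real t * \<zeta> a)\<bar> < 2 * pi"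
      using zeta[OF that] t by (simp add: abs_mult)
    then show ?thesis using exp_neq_1_strip[of "of_real t * \<zeta> a"] zeta[OF that] t by simp
  qed
  have F_nz: "F a \<noteq> 0" if "a \<in> H" for a
    using that f_nz[OF that] a00 t by (auto simp: F_def f' f_a0)
  have F_hol: "F holomorphic_on H"
    unfolding F_def using pole_lemma[OF f_hol a0H] .
  have p_hol: "p holomorphic_on H"
    unfolding p_def using F_nz a00 by (intro holomorphic_intros F_hol) auto
  have N_hol: "N holomorphic_on H"
    unfolding N_def by (intro holomorphic_intros p_hol)
  have G_hol: "G holomorphic_on H"
    unfolding G_def by (intro holomorphic_intros pole_lemma[OF N_hol a0H])
  have N_a0: "N a0 = 0" using a00 t by (simp add: N_def p_def F_def f')
  have fp: "1 - a / a0 = f a * p a" if "a \<in> H" for a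
  proof (cases "a = a0")
    case True
    then show ?thesis using a00 f_a0 by simp
  next
    case False
    with that f_nz a00 show ?thesis by (simp add: p_def F_def f_a0 field_simps)
  qed
  have NG: "N a = G a * (1 - a / a0)" for a
    using a00 N_a0 by (cases "a = a0") (simp_all add: G_def field_simps)
  show ?thesis
  proof (rule that[of p G]; (intro allI impI)?)
    fix a assume "0 < Re a" "a \<noteq> a0"
    then have a: "a \<in> H" "a \<noteq> a0" by (auto simp: H_def)
    have n1: "1 - exp (\<zeta> a) \<noteq> 0" using a a00 by (simp add: zeta)
    have p_eq: "p a = (1 - exp (\<zeta> a)) / f a" using fp[OF a(1)] f_nz[OF a] a by (simp add: zeta(3) field_simps)
    have "G a = N a / (1 - exp (\<zeta> a))" using NG[of a] n1 a by (simp add: zeta)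
    also have "N a / (1 - exp (\<zeta> a)) = 1 / (1 - exp (\<zeta> a)) - of_real t / f a"
    proof -
      have "(1 - s * (D / g)) / D = 1 / D - s / g" if "D \<noteq> 0" for s D g :: complex
        using that by (simp add: diff_divide_distrib)
      from this[OF n1] show ?thesis unfolding N_def p_eq .
    qed
    finally have "G a = 1 / (1 - exp (\<zeta> a)) - of_real t / (1 - exp (of_real t * \<zeta> a))"
      using a by (simp add: zeta(4))
    then show "0 \<le> Re (G a)"
      using Re_inverse_one_minus_exp_scaled[of "\<zeta> a" t] zeta(1,2)[OF a] t by simp
  qed (use p_hol G_hol fp NG in \<open>auto simp: H_def f_def N_def\<close>)
qed

text \<open>With \<open>h = (I - A / a0) y\<close> and \<open>k = p(A) y\<close>, the two identities
  for \<open>p\<close> and \<open>G\<close> become \<open>h = (I - w A^t) k\<close> and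
  \<open>y = G(A) h + t k\<close>, without inverting \<open>I - A / a0\<close>. Then
  \<open>Re <y, h>\<close> is \<open>Re <G(A) h, h> + t Re <k, h>\<close>, a sum of two nonnegative
  terms.\<close>

lemma Re_cinner_power_bound:
  fixes A :: "complex ^ 'n ^ 'n" and t :: real
  assumes A: "accretive A" and t: "0 < t" "t \<le> 1 / 2" and a0: "0 < Re a0"
    and bound: "\<And>x. cmod (cinner (fractional_power A t *v x) x) \<le> cmod a0 powr t * (norm x)\<^sup>2"
  shows "0 \<le> Re (cinner (y - (1 / a0) *s (A *v y)) y)"
proof -
  obtain q R where qq: "0 \<le> q" "q < R" "\<forall>v. norm (A *v v - of_real R *s v) \<le> q * norm v"
    using accretive_disc[OF A] by blast
  define d where "d = cmod (a0 - of_real R)"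
  obtain r1 where r1: "q < r1" "r1 < R" using dense[OF qq(2)] by blast
  obtain r2 where r2: "r1 < r2" "r2 < R" using dense[OF r1(2)] by blast
  \<comment> \<open>The radius avoids \<open>d\<close>, so that \<open>a0\<close> is not on the
    circle: the sign of \<open>Re G\<close> is known only away from \<open>a0\<close>.\<close>
  define r where "r = (if r1 = d then r2 else r1)"
  have rr: "q < r" "r < R" "r \<noteq> d" using r1 r2 by (auto simp: r_def)
  interpret resolvent_circle A "of_real R" q r
    by standard (use qq rr in auto)
  define b where "b = (\<lambda>a. a powr of_real t :: complex)"
  define w where "w = 1 / a0 powr of_real t"
  have a00: "a0 \<noteq> 0" using a0 by auto
  have pos: "0 < Re z" if "z \<in> ball (of_real R) R" for z
    using that abs_Re_le_cmod[of "of_real R - z"] by (simp add: dist_norm)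
  then have half: "ball (of_real R) R \<subseteq> {a. 0 < Re a}" by auto
  have cb: "cball (of_real R :: complex) r \<subseteq> ball (of_real R) R" using rr by auto
  have sp: "sphere (of_real R :: complex) r \<subseteq> ball (of_real R) R" using rr by auto
  obtain p G where p: "p holomorphic_on {a. 0 < Re a}" and G: "G holomorphic_on {a. 0 < Re a}"
    and fp: "\<forall>a. 0 < Re a \<longrightarrow> 1 - a / a0 = (1 - a powr of_real t / a0 powr of_real t) * p a"
    and NG: "\<forall>a. 0 < Re a \<longrightarrow> 1 - of_real t * p a = G a * (1 - a / a0)"
    and G_pos: "\<forall>a. 0 < Re a \<longrightarrow> a \<noteq> a0 \<longrightarrow> 0 \<le> Re (G a)"
    by (rule power_partial_fraction[OF a0 t])
  have p': "p holomorphic_on ball (of_real R) R" and G': "G holomorphic_on ball (of_real R) R"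
    using p G half by (auto elim: holomorphic_on_subset)
  have b: "b holomorphic_on ball (of_real R) R"
    unfolding b_def using pos by (intro holomorphic_intros) (force simp: complex_nonpos_Reals_iff)
  have cont: "continuous_on (sphere (of_real R) r) g" if "g holomorphic_on ball (of_real R) R" for g
    using that holomorphic_on_imp_continuous_on continuous_on_subset sp by blast
  have F_b: "fractional_power A t *v v = fcalc b v" for v
    unfolding b_def by (rule fractional_power_eq_fcalc[OF A resolvent_circle_axioms rr(2)])
  have F_id: "fcalc (\<lambda>a. a) v = A *v v" for v
  proof -
    have "fcalc (\<lambda>a. a) v = fcalc (\<lambda>a. (a - of_real R) * 1 + of_real R) v" by simp
    also have "\<dots> = T *v v + of_real R *s v"
      using fcalc_shift[of "\<lambda>_. 1" v]
      by (subst fcalc_add) (auto intro!: continuous_intros simp: fcalc_const)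
    finally show ?thesis by (simp add: T_vec)
  qed
  have F_lin: "fcalc (\<lambda>a. 1 - \<alpha> * g a) v = v - \<alpha> *s fcalc g v"
    if "g holomorphic_on ball (of_real R) R" for g \<alpha> v
  proof -
    have "fcalc (\<lambda>a. 1 + (- \<alpha>) * g a) v = fcalc (\<lambda>_. 1) v + fcalc (\<lambda>a. (- \<alpha>) * g a) v"
      by (intro fcalc_add continuous_intros cont that)
    also have "\<dots> = v + (- \<alpha>) *s fcalc g v"
      by (simp only: fcalc_one fcalc_scale[OF cont[OF that]])
    finally show ?thesis by (simp add: vec_eq_iff)
  qed
  define k where "k = fcalc p y"
  define h where "h = y - (1 / a0) *s (A *v y)"
  have h: "h = fcalc (\<lambda>a. 1 - a / a0) y"
    using F_lin[of "\<lambda>a. a" "1 / a0" y] by (simp add: h_def F_id holomorphic_on_ident)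
  also have "\<dots> = fcalc (\<lambda>a. (1 - w * b a) * p a) y"
    unfolding fcalc_def
  proof (intro circle_mean_cong)
    fix z :: complex assume "z \<in> sphere (of_real R) r"
    then have "0 < Re z" using sp pos by blast
    then show "(1 - z / a0) *s rho y z = ((1 - w * b z) * p z) *s rho y z"
      by (simp add: fp w_def b_def)
  qed (rule r)
  also have "\<dots> = fcalc (\<lambda>a. 1 - w * b a) k"
    unfolding k_def
    by (rule fcalc_mult[OF _ rr(2)]) (intro holomorphic_intros b holomorphic_on_subset[OF p' cb])+
  also have "\<dots> = k - w *s fcalc b k" by (rule F_lin[OF b])
  finally have hk: "h = k - w *s fcalc b k" .
  have "y - of_real t *s k = fcalc (\<lambda>a. 1 - of_real t * p a) y"
    unfolding k_def by (rule F_lin[OF p', symmetric])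
  also have "\<dots> = fcalc (\<lambda>a. G a * (1 - a / a0)) y"
    unfolding fcalc_def
  proof (intro circle_mean_cong)
    fix z :: complex assume "z \<in> sphere (of_real R) r"
    then have "0 < Re z" using sp pos by blast
    then show "(1 - of_real t * p z) *s rho y z = (G z * (1 - z / a0)) *s rho y z"
      by (simp add: NG)
  qed (rule r)
  also have "\<dots> = fcalc G h"
    unfolding h using a00 by (intro fcalc_mult[OF G' rr(2)] holomorphic_intros) auto
  finally have y: "y = fcalc G h + of_real t *s k" by (simp add: algebra_simps)
  have "0 \<le> Re (cinner (fcalc G h) h)"
  proof (rule Re_fcalc_nonneg[OF G' rr(2)])
    fix z :: complex assume z: "z \<in> sphere (of_real R) r"
    then have "z \<noteq> a0" using rr by (auto simp: d_def dist_norm norm_minus_commute)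
    with z sp pos show "0 \<le> Re (G z)" by (intro G_pos[rule_format]) auto
  qed
  \<comment> \<open>This is where the bound on the fractional power enters: \<open>cmod w\<close> is
    the reciprocal of \<open>cmod a0 powr t\<close>, so \<open>w <A^t k, k>\<close> is at most
    \<open>(norm k)^2\<close> in modulus.\<close>
  moreover have "0 \<le> Re (cinner k h)"
  proof -
    have "cmod (w * cinner (fcalc b k) k) \<le> cmod w * (cmod a0 powr t * (norm k)\<^sup>2)"
      unfolding norm_mult using bound[of k] by (intro mult_left_mono) (simp_all add: F_b)
    also have "\<dots> = (norm k)\<^sup>2"
      using a00 by (simp add: w_def norm_divide norm_powr_real_powr')
    finally have "Re (w * cinner (fcalc b k) k) \<le> (norm k)\<^sup>2"
      using complex_Re_le_cmod order_trans by blast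
    moreover have "cinner k h = cinner k k - cnj (w * cinner (fcalc b k) k)"
      unfolding hk cinner_diff_right cinner_scale_right by (subst cinner_commute[of k "fcalc b k"]) simp
    ultimately show ?thesis by (simp add: cinner_self flip: of_real_power)
  qed
  moreover have "Re (cinner y h) = Re (cinner (fcalc G h) h) + t * Re (cinner k h)"
    by (subst y) (simp add: cinner_add_left cinner_scale_left)
  ultimately have "0 \<le> Re (cinner y h)" using t by simp
  then show ?thesis unfolding h_def Re_cinner by (simp add: inner_commute)
qed

theorem corollary3p6:
  fixes A :: "complex ^ 'n ^ 'n" and t :: real
  assumes "accretive A" and "0 < t" and "t < 1 / 2"
  shows "numerical_radius (fractional_power A t) \<ge> numerical_radius A powr t"
proof (rule ccontr)
  define N where "N = numerical_radius (fractional_power A t)"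
  define B where "B = fractional_power A t"
  assume "\<not> ?thesis"
  then have less: "N < numerical_radius A powr t" by (simp add: N_def)
  obtain x where x: "norm x = 1" "numerical_radius A = cmod (cinner (A *v x) x)"
    using numerical_radius_attained by blast
  define a where "a = cinner (A *v x) x"
  have a: "0 < Re a" using assms(1) x by (auto simp: a_def accretive_def numerical_range_def)
  then have a_pos: "0 < cmod a" by auto
  have N0: "0 \<le> N" using numerical_radius_upper[OF x(1), of "fractional_power A t"] norm_ge_zero order_trans
    unfolding N_def by blast
  \<comment> \<open>The strict gap leaves room for a modulus \<open>\<beta>\<close> with
    \<open>\<beta> powr t = M\<close>: still a bound for the fractional power, yet
    \<open>\<beta> < cmod a\<close>.\<close>
  obtain M where M: "N < M" "M < cmod a powr t" using dense[OF less] by (auto simp: x(2) a_def)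
  define \<beta> where "\<beta> = M powr (1 / t)"
  have \<beta>: "0 < \<beta>" "\<beta> powr t = M" using M N0 assms(2) by (auto simp: \<beta>_def powr_powr)
  have \<beta>_less: "\<beta> < cmod a"
  proof (rule ccontr)
    assume "\<not> \<beta> < cmod a"
    then have "cmod a powr t \<le> \<beta> powr t" using assms(2) by (intro powr_mono2) auto
    with M \<beta> show False by simp
  qed
  \<comment> \<open>\<open>a0\<close> has the direction of \<open>a\<close> and modulus
    \<open>\<beta>\<close>, so \<open>a / a0\<close> is real and greater than 1, against
    \<open>Re (1 - a / a0) >= 0\<close>.\<close>
  define a0 where "a0 = of_real (\<beta> / cmod a) * a"
  have cmod_a0: "cmod a0 = \<beta>" using a_pos \<beta> by (simp add: a0_def norm_mult norm_divide)
  have "0 < Re a0" using a a_pos \<beta> by (simp add: a0_def)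
  moreover have "cmod (cinner (B *v v) v) \<le> cmod a0 powr t * (norm v)\<^sup>2" for v
  proof (cases "v = 0")
    case False
    define u where "u = of_real (1 / norm v) *s v"
    have u: "norm u = 1" "v = of_real (norm v) *s u"
      using False by (simp_all add: u_def norm_vector_scalar_mult norm_divide vec_eq_iff)
    have "cinner (B *v v) v = of_real ((norm v)\<^sup>2) * cinner (B *v u) u"
      by (subst (1 2) u(2)) (simp add: vector_scalar_commute cinner_scale_left cinner_scale_right power2_eq_square)
    then have "cmod (cinner (B *v v) v) = (norm v)\<^sup>2 * cmod (cinner (B *v u) u)"
      by (simp add: norm_mult norm_power)
    also have "\<dots> \<le> (norm v)\<^sup>2 * M"
      using numerical_radius_upper[OF u(1), of B] M(1) by (intro mult_left_mono) (auto simp: N_def B_def)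
    finally show ?thesis by (simp add: cmod_a0 \<beta> mult.commute)
  qed (simp add: cinner_def)
  ultimately have "0 \<le> Re (cinner (x - (1 / a0) *s (A *v x)) x)"
    unfolding B_def using assms(3) by (intro Re_cinner_power_bound[OF assms(1,2)]) auto
  also have "cinner (x - (1 / a0) *s (A *v x)) x = 1 - a / a0"
    by (simp add: cinner_diff_left cinner_scale_left cinner_self x(1) flip: a_def)
  also have "a / a0 = of_real (cmod a / \<beta>)"
    using a_pos by (simp add: a0_def)
  finally show False using \<beta> \<beta>_less by simp
qed

end
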